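(* Let $P$ be an HCP process and let $\mathcal{G}$, $\mathcal{G}'$ be hyperenvironments. If $\vdash P :: \mathcal{G}$ is derivable, $P \Vdash \mathrm{strip}(\mathcal{G}')$ is derivable, and $\mathcal{G}$ and $\mathcal{G}'$ are shufflings of each other, then $\vdash P :: \mathcal{G}'$ is derivable.
   Context: HCP processes (names $x,y,z,\dots$) are generated by: $x[y].P$ (output, binds $y$ in $P$), $x(y).P$ (input, binds $y$), $x[].P$, $x().P$, $x[\mathsf{inl}].P$, $x[\mathsf{inr}].P$, $x.\mathsf{case}(P,Q)$, $!x(y).P$ (binds $y$), $?x[y].P$ (binds $y$), $?x[x_1,x_2].P$ (binds $x_1,x_2$), $?x[].P$, $(\nu xy)P$ (binds $x,y$), $P \mid Q$, $\mathbf{0}$, $[x\leftrightarrow y]$; processes are considered up to $\alpha$-conversion. Types: $A,B ::= A\otimes B \mid A \mathbin{⅋} B \mid A\oplus B \mid A \,\&\, B \mid 1 \mid \bot \mid ?A \mid !A$, with the involutive duality $A^\perp$ given by $(A\otimes B)^\perp = A^\perp ⅋ B^\perp$, $(A\oplus B)^\perp = A^\perp \& B^\perp$, $1^\perp=\bot$, $(?A)^\perp = !A^\perp$ and symmetrically. An environment $\Gamma$ is an unordered finite list $x_1:A_1,\dots,x_n:A_n$ of distinct names with types ($\bullet$ empty); $\Gamma,\Delta$ presupposes disjoint names. A hyperenvironment $\mathcal{G} = \Gamma_1 \mid \cdots \mid \Gamma_n$ is an unordered collection of environments with all names distinct ($\varnothing$ empty); $\mathcal{G}\mid\mathcal{H}$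 presupposes disjoint names. $?\Gamma$ denotes an environment all of whose types have the form $?B$. Typing judgements $\vdash P :: \mathcal{G}$ are derived by the rules: (Ax) $\vdash [x\leftrightarrow y] :: x:A^\perp, y:A$; (H-Cut) from $\vdash P :: \mathcal{G}\mid \Gamma,x:A \mid \Delta, y:A^\perp$ infer $\vdash (\nu xy)P :: \mathcal{G}\mid\Gamma,\Delta$; (H-Mix) from $\vdash P::\mathcal{G}$ and $\vdash Q::\mathcal{H}$ infer $\vdash P\mid Q :: \mathcal{G}\mid\mathcal{H}$; (H-Mix$_0$) $\vdash \mathbf{0}::\varnothing$; ($\otimes$) from $\vdash P :: \mathcal{G}\mid\Gamma,y:A\mid\Delta,x:B$ infer $\vdash x[y].P :: \mathcal{G}\mid\Gamma,\Delta,x:A\otimes B$; ($1$) from $\vdash P::\mathcal{G}$ infer $\vdash x[].P :: \mathcal{G}\mid x:1$; (⅋) from $\vdash P :: \mathcal{G}\mid\Gamma,y:A,x:B$ infer $\vdash x(y).P :: \mathcal{G}\mid\Gamma, x:A⅋B$; ($\bot$) from $\vdash P::\mathcal{G}\mid\Gamma$ infer $\vdash x().P :: \mathcal{G}\mid\Gamma,x:\bot$; ($\oplus_1$) from $\vdash P::\mathcal{G}\mid\Gamma,x:A$ infer $\vdash x[\mathsf{inl}].P :: \mathcal{G}\mid\Gamma,x:A\oplus B$; ($\oplus_2$) from $\vdash P::\mathcal{G}\mid\Gamma,x:B$ infer $\vdash x[\mathsf{inr}].P :: \mathcal{G}\mid\Gamma,x:A\oplus B$; ($\&$) from $\vdash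 P::\Gamma,x:A$ and $\vdash Q::\Gamma,x:B$ infer $\vdash x.\mathsf{case}(P,Q)::\Gamma,x:A\&B$; ($!$) from $\vdash P :: ?\Gamma, y:A$ infer $\vdash !x(y).P :: ?\Gamma, x:!A$; ($?$) from $\vdash P::\mathcal{G}\mid\Gamma,y:A$ infer $\vdash ?x[y].P :: \mathcal{G}\mid\Gamma,x:?A$; (W) from $\vdash P::\mathcal{G}\mid\Gamma$ infer $\vdash ?x[].P::\mathcal{G}\mid\Gamma,x:?A$; (C) from $\vdash P::\mathcal{G}\mid\Gamma,x':?A,x'':?A$ infer $\vdash ?x[x',x''].P::\mathcal{G}\mid\Gamma,x:?A$. Partition judgements $P \Vdash G$, where $G$ is a hyperenvironment of bare names (no types), are derived by the same rules with all types and type constraints erased and $\vdash$ replaced by $\Vdash$. $\mathrm{strip}(\mathcal{G})$ is the name partition obtained by erasing types from $\mathcal{G}$. Two hyperenvironments $\mathcal{G},\mathcal{G}'$ are shufflings of each other if they contain the same number of non-empty environments and, for all $x$ and $A$, $x:A$ occurs in $\mathcal{G}$ iff $x:A$ occurs in $\mathcal{G}'$. *)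

theory Defs
  imports "HOL-Library.Multiset" "HOL-Combinatorics.Transposition"
begin

type_synonym name = nat

datatype ty =
    Tensor ty ty
  | Parr ty ty
  | Plus ty ty
  | With ty ty
  | One
  | Bot
  | WhyNot ty
  | OfCourse ty

primrec dual :: "ty \<Rightarrow> ty" where
  "dual (Tensor A B) = Parr (dual A) (dual B)"
| "dual (Parr A B) = Tensor (dual A) (dual B)"
| "dual (Plus A B) = With (dual A) (dual B)"
| "dual (With A B) = Plus (dual A) (dual B)"
| "dual One = Bot"
| "dual Bot = One"
| "dual (WhyNot A) = OfCourse (dual A)"
| "dual (OfCourse A) = WhyNot (dual A)"


(* \<open>names\<close> collects all names occurring in a raw process, binding occurrences
   included, and \<open>rename f\<close> applies f to all of them, binding occurrences included. *)
datatype (names: 'n) raw_process =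
    ROut 'n 'n "'n raw_process"          (* x[y].P, binds y *)
  | RInp 'n 'n "'n raw_process"          (* x(y).P, binds y *)
  | RClose 'n "'n raw_process"           (* x[].P *)
  | RWait 'n "'n raw_process"            (* x().P *)
  | RSelL 'n "'n raw_process"            (* x[inl].P *)
  | RSelR 'n "'n raw_process"            (* x[inr].P *)
  | RCase 'n "'n raw_process" "'n raw_process"  (* x.case(P,Q) *)
  | RServer 'n 'n "'n raw_process"       (* !x(y).P, binds y *)
  | RClient 'n 'n "'n raw_process"       (* ?x[y].P, binds y *)
  | RDup 'n 'n 'n "'n raw_process"       (* ?x[x1,x2].P, binds x1, x2 *)
  | RDisp 'n "'n raw_process"            (* ?x[].P *)
  | RRes 'n 'n "'n raw_process"          (* (nu x y)P, binds x, y *)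
  | RPar "'n raw_process" "'n raw_process"      (* P | Q *)
  | RNil                                 (* 0 *)
  | RLink 'n 'n                          (* [x <-> y] *)
for map: rename

(* Alpha-equivalence: the bound names of both sides are replaced by common names that
   do not occur at all on either side, so that replacing every occurrence is capture-free.
   In a simultaneous binder that repeats a name the second position shadows the first;
   such a binder is equivalent to one with distinct names. *)
inductive alpha :: "name raw_process \<Rightarrow> name raw_process \<Rightarrow> bool" where
  alpha_Out: "z \<notin> names P \<union> names P' \<Longrightarrow>
    alpha (rename (id(y := z)) P) (rename (id(y' := z)) P') \<Longrightarrow>
    alpha (ROut x y P) (ROut x y' P')"
| alpha_Inp: "z \<notin> names P \<union> names P' \<Longrightarrow>
    alpha (rename (id(y := z)) P) (rename (id(y' := z)) P') \<Longrightarrow>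
    alpha (RInp x y P) (RInp x y' P')"
| alpha_Close: "alpha P P' \<Longrightarrow> alpha (RClose x P) (RClose x P')"
| alpha_Wait: "alpha P P' \<Longrightarrow> alpha (RWait x P) (RWait x P')"
| alpha_SelL: "alpha P P' \<Longrightarrow> alpha (RSelL x P) (RSelL x P')"
| alpha_SelR: "alpha P P' \<Longrightarrow> alpha (RSelR x P) (RSelR x P')"
| alpha_Case: "alpha P P' \<Longrightarrow> alpha Q Q' \<Longrightarrow> alpha (RCase x P Q) (RCase x P' Q')"
| alpha_Server: "z \<notin> names P \<union> names P' \<Longrightarrow>
    alpha (rename (id(y := z)) P) (rename (id(y' := z)) P') \<Longrightarrow>
    alpha (RServer x y P) (RServer x y' P')"
| alpha_Client: "z \<notin> names P \<union> names P' \<Longrightarrow>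
    alpha (rename (id(y := z)) P) (rename (id(y' := z)) P') \<Longrightarrow>
    alpha (RClient x y P) (RClient x y' P')"
| alpha_Dup: "z1 \<noteq> z2 \<Longrightarrow> z1 \<notin> names P \<union> names P' \<Longrightarrow> z2 \<notin> names P \<union> names P' \<Longrightarrow>
    alpha (rename (id(y1 := z1, y2 := z2)) P) (rename (id(y1' := z1, y2' := z2)) P') \<Longrightarrow>
    alpha (RDup x y1 y2 P) (RDup x y1' y2' P')"
| alpha_Disp: "alpha P P' \<Longrightarrow> alpha (RDisp x P) (RDisp x P')"
| alpha_Res: "z1 \<noteq> z2 \<Longrightarrow> z1 \<notin> names P \<union> names P' \<Longrightarrow> z2 \<notin> names P \<union> names P' \<Longrightarrow>
    alpha (rename (id(y1 := z1, y2 := z2)) P) (rename (id(y1' := z1, y2' := z2)) P') \<Longrightarrow>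
    alpha (RRes y1 y2 P) (RRes y1' y2' P')"
| alpha_Par: "alpha P P' \<Longrightarrow> alpha Q Q' \<Longrightarrow> alpha (RPar P Q) (RPar P' Q')"
| alpha_Nil: "alpha RNil RNil"
| alpha_Link: "alpha (RLink x y) (RLink x y)"

lemma finite_names: "finite (names P)"
  by (induction P) auto

lemma rename_update1:
  assumes "inj f"
  shows "rename f (rename (id(y := z)) P) = rename (id(f y := f z)) (rename f P)"
  using assms by (auto simp: raw_process.map_comp inj_eq intro!: raw_process.map_cong0)

lemma rename_update2:
  assumes "inj f"
  shows "rename f (rename (id(y1 := z1, y2 := z2)) P)
       = rename (id(f y1 := f z1, f y2 := f z2)) (rename f P)"
  using assms by (auto simp: raw_process.map_comp inj_eq intro!: raw_process.map_cong0)

lemma alpha_rename: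
  assumes "alpha P Q" "inj f"
  shows "alpha (rename f P) (rename f Q)"
  using assms(1)
proof (induction rule: alpha.induct)
  case (alpha_Out z P P' y y' x)
  then show ?case
    using alpha.alpha_Out[of "f z" "rename f P" "rename f P'" "f y" "f y'" "f x"] assms(2)
    by (auto simp: rename_update1 raw_process.set_map inj_eq inj_image_mem_iff)
next
  case (alpha_Inp z P P' y y' x)
  then show ?case
    using alpha.alpha_Inp[of "f z" "rename f P" "rename f P'" "f y" "f y'" "f x"] assms(2)
    by (auto simp: rename_update1 raw_process.set_map inj_eq inj_image_mem_iff)
next
  case (alpha_Server z P P' y y' x)
  then show ?case
    using alpha.alpha_Server[of "f z" "rename f P" "rename f P'" "f y" "f y'" "f x"] assms(2)
    by (auto simp: rename_update1 raw_process.set_map inj_eq inj_image_mem_iff)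
next
  case (alpha_Client z P P' y y' x)
  then show ?case
    using alpha.alpha_Client[of "f z" "rename f P" "rename f P'" "f y" "f y'" "f x"] assms(2)
    by (auto simp: rename_update1 raw_process.set_map inj_eq inj_image_mem_iff)
next
  case (alpha_Dup z1 z2 P P' y1 y2 y1' y2' x)
  then show ?case
    using alpha.alpha_Dup[of "f z1" "f z2" "rename f P" "rename f P'" "f y1" "f y2" "f y1'" "f y2'" "f x"]
      assms(2)
    by (auto simp: rename_update2 raw_process.set_map inj_eq inj_image_mem_iff)
next
  case (alpha_Res z1 z2 P P' y1 y2 y1' y2')
  then show ?case
    using alpha.alpha_Res[of "f z1" "f z2" "rename f P" "rename f P'" "f y1" "f y2" "f y1'" "f y2'"]
      assms(2)
    by (auto simp: rename_update2 raw_process.set_map inj_eq inj_image_mem_iff)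
qed (auto intro: alpha.intros)

lemma alpha_rename_on:
  assumes "alpha P Q" "inj_on f (names P \<union> names Q)"
  shows "alpha (rename f P) (rename f Q)"
proof -
  let ?S = "names P \<union> names Q"
  have fin: "finite ?S" by (simp add: finite_names)
  obtain k where k: "\<forall>a \<in> ?S \<union> f ` ?S. a < k"
    using fin by (meson finite_nat_set_iff_bounded finite_UnI finite_imageI)
  define g where "g a = (if a \<in> ?S then f a else a + k)" for a
  have "inj g"
  proof (rule injI)
    fix a b assume eq: "g a = g b"
    have "f c < k" if "c \<in> ?S" for c using k that by blast
    with eq assms(2) show "a = b"
      by (auto simp: g_def inj_on_def split: if_splits dest: leD)
        (metis le_add2 leD)+
  qed
  then have "alpha (rename g P) (rename g Q)" using assms(1) by (rule alpha_rename[rotated])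
  moreover have "rename g P = rename f P" "rename g Q = rename f Q"
    by (auto simp: g_def intro!: raw_process.map_cong0)
  ultimately show ?thesis by simp
qed

lemma alpha_fresh1:
  assumes "alpha (rename (id(y := z)) P) (rename (id(y' := z)) P')"
    and "z \<notin> names P \<union> names P'" "w \<notin> names P \<union> names P'"
  shows "alpha (rename (id(y := w)) P) (rename (id(y' := w)) P')"
proof -
  have *: "rename (transpose z w) (rename (id(v := z)) R) = rename (id(v := w)) R"
    if "z \<notin> names R" "w \<notin> names R" for v R
    using that by (auto simp: raw_process.map_comp transpose_def intro!: raw_process.map_cong0)
  show ?thesis
    using alpha_rename[OF assms(1), of "transpose z w"] assms(2,3) by (simp add: *)
qed

lemma alpha_fresh2:
  assumes "alpha (rename (id(y1 := z1, y2 := z2)) P) (rename (id(y1' := z1, y2' := z2)) P')"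
    and "z1 \<noteq> z2" "z1 \<notin> names P \<union> names P'" "z2 \<notin> names P \<union> names P'"
    and "w1 \<noteq> w2" "w1 \<notin> names P \<union> names P' \<union> {z1, z2}" "w2 \<notin> names P \<union> names P' \<union> {z1, z2}"
  shows "alpha (rename (id(y1 := w1, y2 := w2)) P) (rename (id(y1' := w1, y2' := w2)) P')"
proof -
  let ?f = "transpose z1 w1 \<circ> transpose z2 w2"
  have *: "rename ?f (rename (id(v1 := z1, v2 := z2)) R) = rename (id(v1 := w1, v2 := w2)) R"
    if "{z1, z2, w1, w2} \<inter> names R = {}" for v1 v2 R
    using that assms
    by (auto simp: raw_process.map_comp transpose_def intro!: raw_process.map_cong0)
  have "inj ?f" by (simp add: inj_compose)
  moreover have "{z1, z2, w1, w2} \<inter> names P = {}" "{z1, z2, w1, w2} \<inter> names P' = {}"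
    using assms by auto
  ultimately show ?thesis
    using alpha_rename[OF assms(1), of ?f] by (metis *)
qed

lemma obtain_fresh2:
  assumes "finite S"
  obtains z1 z2 :: name where "z1 \<noteq> z2" "z1 \<notin> S" "z2 \<notin> S"
proof -
  obtain z1 where "z1 \<notin> S" using ex_new_if_finite[OF infinite_UNIV_nat assms] by blast
  moreover obtain z2 where "z2 \<notin> insert z1 S"
    using ex_new_if_finite[OF infinite_UNIV_nat, of "insert z1 S"] assms by blast
  ultimately show thesis using that[of z1 z2] by blast
qed

lemma alpha_cong1:
  assumes "alpha P Q"
  shows "\<exists>z. z \<notin> names P \<union> names Q \<and> alpha (rename (id(y := z)) P) (rename (id(y := z)) Q)"
proof -
  obtain z where z: "z \<notin> names P \<union> names Q"
    using ex_new_if_finite[OF infinite_UNIV_nat, of "names P \<union> names Q"] finite_names by auto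
  then have "inj_on (id(y := z)) (names P \<union> names Q)" by (auto simp: inj_on_def)
  with assms z show ?thesis by (blast intro: alpha_rename_on)
qed

lemma alpha_cong2:
  assumes "alpha P Q"
  shows "\<exists>z1 z2. z1 \<noteq> z2 \<and> z1 \<notin> names P \<union> names Q \<and> z2 \<notin> names P \<union> names Q
    \<and> alpha (rename (id(y1 := z1, y2 := z2)) P) (rename (id(y1 := z1, y2 := z2)) Q)"
proof -
  obtain z1 z2 where z: "z1 \<noteq> z2" "z1 \<notin> names P \<union> names Q" "z2 \<notin> names P \<union> names Q"
    by (rule obtain_fresh2[of "names P \<union> names Q"]) (auto simp: finite_names)
  then have "inj_on (id(y1 := z1, y2 := z2)) (names P \<union> names Q)" by (auto simp: inj_on_def)
  with assms z show ?thesis by (blast intro: alpha_rename_on)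
qed

lemma alpha_congs:
  assumes "alpha P Q"
  shows "alpha (ROut x y P) (ROut x y Q)" "alpha (RInp x y P) (RInp x y Q)"
    "alpha (RServer x y P) (RServer x y Q)" "alpha (RClient x y P) (RClient x y Q)"
    "alpha (RDup x y1 y2 P) (RDup x y1 y2 Q)" "alpha (RRes y1 y2 P) (RRes y1 y2 Q)"
proof -
  obtain z where z: "z \<notin> names P \<union> names Q" "alpha (rename (id(y := z)) P) (rename (id(y := z)) Q)"
    using alpha_cong1[OF assms] by blast
  show "alpha (ROut x y P) (ROut x y Q)" "alpha (RInp x y P) (RInp x y Q)"
    "alpha (RServer x y P) (RServer x y Q)" "alpha (RClient x y P) (RClient x y Q)"
    using z by (rule alpha.intros)+
  obtain z1 z2 where z: "z1 \<noteq> z2" "z1 \<notin> names P \<union> names Q" "z2 \<notin> names P \<union> names Q"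
    "alpha (rename (id(y1 := z1, y2 := z2)) P) (rename (id(y1 := z1, y2 := z2)) Q)"
    using alpha_cong2[OF assms] by blast
  show "alpha (RDup x y1 y2 P) (RDup x y1 y2 Q)" "alpha (RRes y1 y2 P) (RRes y1 y2 Q)"
    using z by (rule alpha.intros)+
qed

lemma alpha_refl: "alpha P P"
  by (induction P) (auto intro: alpha_congs alpha.intros(3-7,11,13-))

lemma alpha_sym: "alpha P Q \<Longrightarrow> alpha Q P"
  by (induction rule: alpha.induct) (auto intro: alpha.intros)

lemma size_rename: "size (rename f P) = size P"
  by (induction P) auto

lemma alpha_trans1:
  assumes "alpha (rename (id(y := z)) P) (rename (id(y' := z)) P')" "z \<notin> names P \<union> names P'"
    and "alpha (rename (id(y' := z')) P') (rename (id(y'' := z')) P'')" "z' \<notin> names P' \<union> names P''"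
    and IH: "\<forall>f Q R. alpha (rename f P) Q \<longrightarrow> alpha Q R \<longrightarrow> alpha (rename f P) R"
  shows "\<exists>w. w \<notin> names P \<union> names P'' \<and> alpha (rename (id(y := w)) P) (rename (id(y'' := w)) P'')"
proof -
  obtain w where w: "w \<notin> names P \<union> names P' \<union> names P''"
    using ex_new_if_finite[OF infinite_UNIV_nat, of "names P \<union> names P' \<union> names P''"]
      finite_names by auto
  then have "alpha (rename (id(y := w)) P) (rename (id(y' := w)) P')"
    "alpha (rename (id(y' := w)) P') (rename (id(y'' := w)) P'')"
    using alpha_fresh1[OF assms(1,2)] alpha_fresh1[OF assms(3,4)] by auto
  with w IH show ?thesis by blast
qed

lemma alpha_trans2:
  assumes "alpha (rename (id(y1 := z1, y2 := z2)) P) (rename (id(y1' := z1, y2' := z2)) P')"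
    "z1 \<noteq> z2" "z1 \<notin> names P \<union> names P'" "z2 \<notin> names P \<union> names P'"
    and "alpha (rename (id(y1' := z1', y2' := z2')) P') (rename (id(y1'' := z1', y2'' := z2')) P'')"
    "z1' \<noteq> z2'" "z1' \<notin> names P' \<union> names P''" "z2' \<notin> names P' \<union> names P''"
    and IH: "\<forall>f Q R. alpha (rename f P) Q \<longrightarrow> alpha Q R \<longrightarrow> alpha (rename f P) R"
  shows "\<exists>w1 w2. w1 \<noteq> w2 \<and> w1 \<notin> names P \<union> names P'' \<and> w2 \<notin> names P \<union> names P'' \<and>
    alpha (rename (id(y1 := w1, y2 := w2)) P) (rename (id(y1'' := w1, y2'' := w2)) P'')"
proof -
  let ?S = "names P \<union> names P' \<union> names P'' \<union> {z1, z2, z1', z2'}"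
  obtain w1 w2 where w: "w1 \<noteq> w2" "w1 \<notin> ?S" "w2 \<notin> ?S"
    by (rule obtain_fresh2[of ?S]) (auto simp: finite_names)
  then have "alpha (rename (id(y1 := w1, y2 := w2)) P) (rename (id(y1' := w1, y2' := w2)) P')"
    "alpha (rename (id(y1' := w1, y2' := w2)) P') (rename (id(y1'' := w1, y2'' := w2)) P'')"
    using alpha_fresh2[OF assms(1-4)] alpha_fresh2[OF assms(5-8)] by auto
  with w IH show ?thesis by blast
qed

inductive_cases alpha_elims:
  "alpha (ROut x y P) R" "alpha (RInp x y P) R" "alpha (RClose x P) R" "alpha (RWait x P) R"
  "alpha (RSelL x P) R" "alpha (RSelR x P) R" "alpha (RCase x P Q) R" "alpha (RServer x y P) R"
  "alpha (RClient x y P) R" "alpha (RDup x y1 y2 P) R" "alpha (RDisp x P) R" "alpha (RRes y1 y2 P) R"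
  "alpha (RPar P Q) R" "alpha RNil R" "alpha (RLink x y) R"

lemma alpha_trans: "alpha P Q \<Longrightarrow> alpha Q R \<Longrightarrow> alpha P R"
proof (induction "size P" arbitrary: P Q R rule: less_induct)
  case less
  have IH: "alpha (rename f P') Q' \<Longrightarrow> alpha Q' R' \<Longrightarrow> alpha (rename f P') R'"
    if "size P' < size P" for f P' Q' R'
    using less.hyps[of "rename f P'"] that by (simp add: size_rename)
  have IH': "alpha P' Q' \<Longrightarrow> alpha Q' R' \<Longrightarrow> alpha P' R'" if "size P' < size P" for P' Q' R'
    using less.hyps that by blast
  from less.prems(1) show ?case
  proof cases
    case (alpha_Out z P1 Q1 y y' x)
    from less.prems(2)[unfolded alpha_Out(2)] obtain z' R1 y'' where R: "R = ROut x y'' R1"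
      "z' \<notin> names Q1 \<union> names R1" "alpha (rename (id(y' := z')) Q1) (rename (id(y'' := z')) R1)"
      by (elim alpha_elims(1)) blast
    have IH1: "\<forall>f Q' R'. alpha (rename f P1) Q' \<longrightarrow> alpha Q' R' \<longrightarrow> alpha (rename f P1) R'"
      using IH[of P1] by (simp add: alpha_Out(1))
    from alpha_trans1[OF alpha_Out(4,3) R(3,2) IH1]
    show ?thesis unfolding alpha_Out(1) R(1) by (blast intro: alpha.alpha_Out)
  next
    case (alpha_Inp z P1 Q1 y y' x)
    from less.prems(2)[unfolded alpha_Inp(2)] obtain z' R1 y'' where R: "R = RInp x y'' R1"
      "z' \<notin> names Q1 \<union> names R1" "alpha (rename (id(y' := z')) Q1) (rename (id(y'' := z')) R1)"
      by (elim alpha_elims(2)) blast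
    have IH1: "\<forall>f Q' R'. alpha (rename f P1) Q' \<longrightarrow> alpha Q' R' \<longrightarrow> alpha (rename f P1) R'"
      using IH[of P1] by (simp add: alpha_Inp(1))
    from alpha_trans1[OF alpha_Inp(4,3) R(3,2) IH1]
    show ?thesis unfolding alpha_Inp(1) R(1) by (blast intro: alpha.alpha_Inp)
  next
    case (alpha_Server z P1 Q1 y y' x)
    from less.prems(2)[unfolded alpha_Server(2)] obtain z' R1 y'' where R: "R = RServer x y'' R1"
      "z' \<notin> names Q1 \<union> names R1" "alpha (rename (id(y' := z')) Q1) (rename (id(y'' := z')) R1)"
      by (elim alpha_elims(8)) blast
    have IH1: "\<forall>f Q' R'. alpha (rename f P1) Q' \<longrightarrow> alpha Q' R' \<longrightarrow> alpha (rename f P1) R'"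
      using IH[of P1] by (simp add: alpha_Server(1))
    from alpha_trans1[OF alpha_Server(4,3) R(3,2) IH1]
    show ?thesis unfolding alpha_Server(1) R(1) by (blast intro: alpha.alpha_Server)
  next
    case (alpha_Client z P1 Q1 y y' x)
    from less.prems(2)[unfolded alpha_Client(2)] obtain z' R1 y'' where R: "R = RClient x y'' R1"
      "z' \<notin> names Q1 \<union> names R1" "alpha (rename (id(y' := z')) Q1) (rename (id(y'' := z')) R1)"
      by (elim alpha_elims(9)) blast
    have IH1: "\<forall>f Q' R'. alpha (rename f P1) Q' \<longrightarrow> alpha Q' R' \<longrightarrow> alpha (rename f P1) R'"
      using IH[of P1] by (simp add: alpha_Client(1))
    from alpha_trans1[OF alpha_Client(4,3) R(3,2) IH1]
    show ?thesis unfolding alpha_Client(1) R(1) by (blast intro: alpha.alpha_Client)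
  next
    case (alpha_Dup z1 z2 P1 Q1 y1 y2 y1' y2' x)
    from less.prems(2)[unfolded alpha_Dup(2)] obtain z1' z2' R1 y1'' y2'' where R: "R = RDup x y1'' y2'' R1"
      "z1' \<noteq> z2'" "z1' \<notin> names Q1 \<union> names R1" "z2' \<notin> names Q1 \<union> names R1"
      "alpha (rename (id(y1' := z1', y2' := z2')) Q1) (rename (id(y1'' := z1', y2'' := z2')) R1)"
      by (elim alpha_elims(10)) blast
    have IH1: "\<forall>f Q' R'. alpha (rename f P1) Q' \<longrightarrow> alpha Q' R' \<longrightarrow> alpha (rename f P1) R'"
      using IH[of P1] by (simp add: alpha_Dup(1))
    from alpha_trans2[OF alpha_Dup(6,3-5) R(5,2-4) IH1]
    show ?thesis unfolding alpha_Dup(1) R(1) by (blast intro: alpha.alpha_Dup)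
  next
    case (alpha_Res z1 z2 P1 Q1 y1 y2 y1' y2')
    from less.prems(2)[unfolded alpha_Res(2)] obtain z1' z2' R1 y1'' y2'' where R: "R = RRes y1'' y2'' R1"
      "z1' \<noteq> z2'" "z1' \<notin> names Q1 \<union> names R1" "z2' \<notin> names Q1 \<union> names R1"
      "alpha (rename (id(y1' := z1', y2' := z2')) Q1) (rename (id(y1'' := z1', y2'' := z2')) R1)"
      by (elim alpha_elims(12)) blast
    have IH1: "\<forall>f Q' R'. alpha (rename f P1) Q' \<longrightarrow> alpha Q' R' \<longrightarrow> alpha (rename f P1) R'"
      using IH[of P1] by (simp add: alpha_Res(1))
    from alpha_trans2[OF alpha_Res(6,3-5) R(5,2-4) IH1]
    show ?thesis unfolding alpha_Res(1) R(1) by (blast intro: alpha.alpha_Res)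
  qed (use less.prems(2) in \<open>auto elim!: alpha_elims intro!: alpha.intros(3-7,11,13-15) elim: IH'[rotated]\<close>)
qed

quotient_type process = "name raw_process" / alpha
  by (intro equivpI reflpI sympI transpI) (blast intro: alpha_refl alpha_sym alpha_trans)+

lift_definition Out :: "name \<Rightarrow> name \<Rightarrow> process \<Rightarrow> process" is ROut by (rule alpha_congs)
lift_definition Inp :: "name \<Rightarrow> name \<Rightarrow> process \<Rightarrow> process" is RInp by (rule alpha_congs)
lift_definition Close :: "name \<Rightarrow> process \<Rightarrow> process" is RClose by (rule alpha.intros)
lift_definition Wait :: "name \<Rightarrow> process \<Rightarrow> process" is RWait by (rule alpha.intros)
lift_definition SelL :: "name \<Rightarrow> process \<Rightarrow> process" is RSelL by (rule alpha.intros)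
lift_definition SelR :: "name \<Rightarrow> process \<Rightarrow> process" is RSelR by (rule alpha.intros)
lift_definition Case :: "name \<Rightarrow> process \<Rightarrow> process \<Rightarrow> process" is RCase by (rule alpha.intros)
lift_definition Server :: "name \<Rightarrow> name \<Rightarrow> process \<Rightarrow> process" is RServer by (rule alpha_congs)
lift_definition Client :: "name \<Rightarrow> name \<Rightarrow> process \<Rightarrow> process" is RClient by (rule alpha_congs)
lift_definition Dup :: "name \<Rightarrow> name \<Rightarrow> name \<Rightarrow> process \<Rightarrow> process" is RDup by (rule alpha_congs)
lift_definition Disp :: "name \<Rightarrow> process \<Rightarrow> process" is RDisp by (rule alpha.intros)
lift_definition Res :: "name \<Rightarrow> name \<Rightarrow> process \<Rightarrow> process" is RRes by (rule alpha_congs)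
lift_definition Par :: "process \<Rightarrow> process \<Rightarrow> process" is RPar by (rule alpha.intros)
lift_definition Nil0 :: process is RNil .
lift_definition Link :: "name \<Rightarrow> name \<Rightarrow> process" is RLink .


(* Environments and hyperenvironments are multisets: "," is + on the inner level, "|" is +
   on the outer level, {#} is the empty (hyper)environment, and a hyperenvironment may
   contain (several copies of) the empty environment.  Distinctness of names is expressed
   by \<open>distinct_names\<close> / \<open>hyperenv\<close>. *)
type_synonym env = "(name \<times> ty) multiset"
type_synonym henv = "env multiset"
type_synonym name_partition = "name multiset multiset"

definition distinct_names :: "name_partition \<Rightarrow> bool" where
  "distinct_names N \<longleftrightarrow> (\<forall>x. count (\<Sum>\<^sub># N) x \<le> 1)"

definition strip :: "henv \<Rightarrow> name_partition" where
  "strip \<G> = image_mset (image_mset fst) \<G>"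

definition hyperenv :: "henv \<Rightarrow> bool" where
  "hyperenv \<G> \<longleftrightarrow> distinct_names (strip \<G>)"

definition shuffling :: "henv \<Rightarrow> henv \<Rightarrow> bool" where
  "shuffling \<G> \<G>' \<longleftrightarrow>
     size {#\<Gamma> \<in># \<G>. \<Gamma> \<noteq> {#}#} = size {#\<Gamma> \<in># \<G>'. \<Gamma> \<noteq> {#}#} \<and>
     (\<forall>x A. (\<exists>\<Gamma> \<in># \<G>. (x, A) \<in># \<Gamma>) \<longleftrightarrow> (\<exists>\<Gamma> \<in># \<G>'. (x, A) \<in># \<Gamma>))"

definition all_whynot :: "env \<Rightarrow> bool" where
  "all_whynot \<Gamma> \<longleftrightarrow> (\<forall>(x, A) \<in># \<Gamma>. \<exists>B. A = WhyNot B)"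

(* The presupposition that the names of a hyperenvironment are distinct is an explicit
   premise of every rule whose conclusion does not inherit it from the premises. *)
inductive typing :: "process \<Rightarrow> henv \<Rightarrow> bool"  ("(\<turnstile> _ \<Colon> _)" [61, 61] 60) where
  T_Ax: "hyperenv {#{#(x, dual A), (y, A)#}#} \<Longrightarrow>
    \<turnstile> Link x y \<Colon> {#{#(x, dual A), (y, A)#}#}"
| T_Cut: "\<turnstile> P \<Colon> \<G> + {#\<Gamma> + {#(x, A)#}, \<Delta> + {#(y, dual A)#}#} \<Longrightarrow>
    \<turnstile> Res x y P \<Colon> \<G> + {#\<Gamma> + \<Delta>#}"
| T_Mix: "\<turnstile> P \<Colon> \<G> \<Longrightarrow> \<turnstile> Q \<Colon> \<H> \<Longrightarrow> hyperenv (\<G> + \<H>) \<Longrightarrow>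
    \<turnstile> Par P Q \<Colon> \<G> + \<H>"
| T_Mix0: "\<turnstile> Nil0 \<Colon> {#}"
| T_Tensor: "\<turnstile> P \<Colon> \<G> + {#\<Gamma> + {#(y, A)#}, \<Delta> + {#(x, B)#}#} \<Longrightarrow>
    \<turnstile> Out x y P \<Colon> \<G> + {#\<Gamma> + \<Delta> + {#(x, Tensor A B)#}#}"
| T_One: "\<turnstile> P \<Colon> \<G> \<Longrightarrow> hyperenv (\<G> + {#{#(x, One)#}#}) \<Longrightarrow>
    \<turnstile> Close x P \<Colon> \<G> + {#{#(x, One)#}#}"
| T_Parr: "\<turnstile> P \<Colon> \<G> + {#\<Gamma> + {#(y, A), (x, B)#}#} \<Longrightarrow>
    \<turnstile> Inp x y P \<Colon> \<G> + {#\<Gamma> + {#(x, Parr A B)#}#}"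
| T_Bot: "\<turnstile> P \<Colon> \<G> + {#\<Gamma>#} \<Longrightarrow> hyperenv (\<G> + {#\<Gamma> + {#(x, Bot)#}#}) \<Longrightarrow>
    \<turnstile> Wait x P \<Colon> \<G> + {#\<Gamma> + {#(x, Bot)#}#}"
| T_Plus1: "\<turnstile> P \<Colon> \<G> + {#\<Gamma> + {#(x, A)#}#} \<Longrightarrow>
    \<turnstile> SelL x P \<Colon> \<G> + {#\<Gamma> + {#(x, Plus A B)#}#}"
| T_Plus2: "\<turnstile> P \<Colon> \<G> + {#\<Gamma> + {#(x, B)#}#} \<Longrightarrow>
    \<turnstile> SelR x P \<Colon> \<G> + {#\<Gamma> + {#(x, Plus A B)#}#}"
| T_With: "\<turnstile> P \<Colon> {#\<Gamma> + {#(x, A)#}#} \<Longrightarrow> \<turnstile> Q \<Colon> {#\<Gamma> + {#(x, B)#}#} \<Longrightarrow>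
    \<turnstile> Case x P Q \<Colon> {#\<Gamma> + {#(x, With A B)#}#}"
| T_OfCourse: "\<turnstile> P \<Colon> {#\<Gamma> + {#(y, A)#}#} \<Longrightarrow> all_whynot \<Gamma> \<Longrightarrow>
    hyperenv {#\<Gamma> + {#(x, OfCourse A)#}#} \<Longrightarrow>
    \<turnstile> Server x y P \<Colon> {#\<Gamma> + {#(x, OfCourse A)#}#}"
| T_WhyNot: "\<turnstile> P \<Colon> \<G> + {#\<Gamma> + {#(y, A)#}#} \<Longrightarrow>
    hyperenv (\<G> + {#\<Gamma> + {#(x, WhyNot A)#}#}) \<Longrightarrow>
    \<turnstile> Client x y P \<Colon> \<G> + {#\<Gamma> + {#(x, WhyNot A)#}#}"
| T_Weaken: "\<turnstile> P \<Colon> \<G> + {#\<Gamma>#} \<Longrightarrow> hyperenv (\<G> + {#\<Gamma> + {#(x, WhyNot A)#}#}) \<Longrightarrow>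
    \<turnstile> Disp x P \<Colon> \<G> + {#\<Gamma> + {#(x, WhyNot A)#}#}"
| T_Contract: "\<turnstile> P \<Colon> \<G> + {#\<Gamma> + {#(x1, WhyNot A), (x2, WhyNot A)#}#} \<Longrightarrow>
    hyperenv (\<G> + {#\<Gamma> + {#(x, WhyNot A)#}#}) \<Longrightarrow>
    \<turnstile> Dup x x1 x2 P \<Colon> \<G> + {#\<Gamma> + {#(x, WhyNot A)#}#}"

inductive partitioning :: "process \<Rightarrow> name_partition \<Rightarrow> bool"  ("(_ \<tturnstile> _)" [61, 61] 60) where
  P_Ax: "distinct_names {#{#x, y#}#} \<Longrightarrow>
    Link x y \<tturnstile> {#{#x, y#}#}"
| P_Cut: "P \<tturnstile> G + {#\<Gamma> + {#x#}, \<Delta> + {#y#}#} \<Longrightarrow>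
    Res x y P \<tturnstile> G + {#\<Gamma> + \<Delta>#}"
| P_Mix: "P \<tturnstile> G \<Longrightarrow> Q \<tturnstile> H \<Longrightarrow> distinct_names (G + H) \<Longrightarrow>
    Par P Q \<tturnstile> G + H"
| P_Mix0: "Nil0 \<tturnstile> {#}"
| P_Tensor: "P \<tturnstile> G + {#\<Gamma> + {#y#}, \<Delta> + {#x#}#} \<Longrightarrow>
    Out x y P \<tturnstile> G + {#\<Gamma> + \<Delta> + {#x#}#}"
| P_One: "P \<tturnstile> G \<Longrightarrow> distinct_names (G + {#{#x#}#}) \<Longrightarrow>
    Close x P \<tturnstile> G + {#{#x#}#}"
| P_Parr: "P \<tturnstile> G + {#\<Gamma> + {#y, x#}#} \<Longrightarrow>
    Inp x y P \<tturnstile> G + {#\<Gamma> + {#x#}#}"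
| P_Bot: "P \<tturnstile> G + {#\<Gamma>#} \<Longrightarrow> distinct_names (G + {#\<Gamma> + {#x#}#}) \<Longrightarrow>
    Wait x P \<tturnstile> G + {#\<Gamma> + {#x#}#}"
| P_Plus1: "P \<tturnstile> G + {#\<Gamma> + {#x#}#} \<Longrightarrow>
    SelL x P \<tturnstile> G + {#\<Gamma> + {#x#}#}"
| P_Plus2: "P \<tturnstile> G + {#\<Gamma> + {#x#}#} \<Longrightarrow>
    SelR x P \<tturnstile> G + {#\<Gamma> + {#x#}#}"
| P_With: "P \<tturnstile> {#\<Gamma> + {#x#}#} \<Longrightarrow> Q \<tturnstile> {#\<Gamma> + {#x#}#} \<Longrightarrow>
    Case x P Q \<tturnstile> {#\<Gamma> + {#x#}#}"
| P_OfCourse: "P \<tturnstile> {#\<Gamma> + {#y#}#} \<Longrightarrow> distinct_names {#\<Gamma> + {#x#}#} \<Longrightarrow>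
    Server x y P \<tturnstile> {#\<Gamma> + {#x#}#}"
| P_WhyNot: "P \<tturnstile> G + {#\<Gamma> + {#y#}#} \<Longrightarrow> distinct_names (G + {#\<Gamma> + {#x#}#}) \<Longrightarrow>
    Client x y P \<tturnstile> G + {#\<Gamma> + {#x#}#}"
| P_Weaken: "P \<tturnstile> G + {#\<Gamma>#} \<Longrightarrow> distinct_names (G + {#\<Gamma> + {#x#}#}) \<Longrightarrow>
    Disp x P \<tturnstile> G + {#\<Gamma> + {#x#}#}"
| P_Contract: "P \<tturnstile> G + {#\<Gamma> + {#x1, x2#}#} \<Longrightarrow> distinct_names (G + {#\<Gamma> + {#x#}#}) \<Longrightarrow>
    Dup x x1 x2 P \<tturnstile> G + {#\<Gamma> + {#x#}#}"

lemma distinct_names_mono: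
  "distinct_names M \<Longrightarrow> \<Sum>\<^sub># N \<subseteq># \<Sum>\<^sub># M \<Longrightarrow> distinct_names N"
  unfolding distinct_names_def by (meson le_trans mset_subset_eq_count)

lemma typing_hyperenv: "\<turnstile> P \<Colon> \<G> \<Longrightarrow> hyperenv \<G>"
proof (induction rule: typing.induct)
  case T_Mix0
  show ?case by (simp add: hyperenv_def distinct_names_def strip_def)
next
  case (T_Cut P \<G> \<Gamma> x A \<Delta> y)
  show ?case using T_Cut.IH unfolding hyperenv_def
    by (rule distinct_names_mono) (simp add: strip_def subseteq_mset_def)
next
  case (T_Tensor P \<G> \<Gamma> y A \<Delta> x B)
  show ?case using T_Tensor.IH unfolding hyperenv_def
    by (rule distinct_names_mono) (simp add: strip_def subseteq_mset_def)
next
  case (T_Parr P \<G> \<Gamma> y A x B)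
  show ?case using T_Parr.IH unfolding hyperenv_def
    by (rule distinct_names_mono) (simp add: strip_def subseteq_mset_def)
qed (simp_all add: hyperenv_def strip_def)

lemma partitioning_distinct_names: "P \<tturnstile> N \<Longrightarrow> distinct_names N"
proof (induction rule: partitioning.induct)
  case P_Mix0
  show ?case by (simp add: distinct_names_def)
next
  case (P_Cut P G \<Gamma> x \<Delta> y)
  show ?case using P_Cut.IH by (rule distinct_names_mono) (simp add: subseteq_mset_def)
next
  case (P_Tensor P G \<Gamma> y \<Delta> x)
  show ?case using P_Tensor.IH by (rule distinct_names_mono) (simp add: subseteq_mset_def)
next
  case (P_Parr P G \<Gamma> y x)
  show ?case using P_Parr.IH by (rule distinct_names_mono) (simp add: subseteq_mset_def)
qed assumption+

end

theory Submission
  imports Defs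
begin

text \<open>
  Since names are distinct, two shufflings have the same typed names as multisets. By induction on
  the typing derivation, the partition derivation dictates where each rule splits the
  hyperenvironment, while the typing derivation supplies the types of the principal and bound names;
  the two agree because a name carries only one type, and a parallel composition distributes its
  typed names according to the free names of its components. As processes are taken up to alpha,
  the partition derivation may use other bound names than the typing derivation, so partitions are
  inverted modulo an injective renaming that fixes the free names.
\<close>

section \<open>Free names, renaming and inversion on processes\<close>

primrec raw_fn :: "name raw_process \<Rightarrow> name set" where
  "raw_fn (ROut x y P) = insert x (raw_fn P - {y})"
| "raw_fn (RInp x y P) = insert x (raw_fn P - {y})"
| "raw_fn (RClose x P) = insert x (raw_fn P)"
| "raw_fn (RWait x P) = insert x (raw_fn P)"
| "raw_fn (RSelL x P) = insert x (raw_fn P)"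
| "raw_fn (RSelR x P) = insert x (raw_fn P)"
| "raw_fn (RCase x P Q) = insert x (raw_fn P \<union> raw_fn Q)"
| "raw_fn (RServer x y P) = insert x (raw_fn P - {y})"
| "raw_fn (RClient x y P) = insert x (raw_fn P - {y})"
| "raw_fn (RDup x y1 y2 P) = insert x (raw_fn P - {y1, y2})"
| "raw_fn (RDisp x P) = insert x (raw_fn P)"
| "raw_fn (RRes y1 y2 P) = raw_fn P - {y1, y2}"
| "raw_fn (RPar P Q) = raw_fn P \<union> raw_fn Q"
| "raw_fn RNil = {}"
| "raw_fn (RLink x y) = {x, y}"

lemma raw_fn_subset_names: "raw_fn P \<subseteq> names P"
  by (induction P) auto

text \<open>Injectivity is required on bound names as well: it is what makes removing a bound name
  commute with taking images, so that no free name is captured.\<close>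

lemma raw_fn_rename:
  assumes "inj_on f (names P)"
  shows "raw_fn (rename f P) = f ` raw_fn P"
proof -
  have diff1: "f ` A - {f y} = f ` (A - {y})" if "inj_on f (insert y A)" for A y
    using that by (auto simp: inj_on_def)
  have diff2: "f ` A - {f y1, f y2} = f ` (A - {y1, y2})" if "inj_on f (insert y1 (insert y2 A))" for A y1 y2
    using that by (auto simp: inj_on_def)
  show ?thesis
    using assms
  proof (induction P)
    case (ROut x y P)
    have "inj_on f (names P)" "inj_on f (insert y (raw_fn P))"
      using ROut.prems raw_fn_subset_names[of P] by (auto intro: inj_on_subset)
    then show ?case using ROut.IH by (simp add: diff1)
  next
    case (RInp x y P)
    have "inj_on f (names P)" "inj_on f (insert y (raw_fn P))"
      using RInp.prems raw_fn_subset_names[of P] by (auto intro: inj_on_subset)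
    then show ?case using RInp.IH by (simp add: diff1)
  next
    case (RServer x y P)
    have "inj_on f (names P)" "inj_on f (insert y (raw_fn P))"
      using RServer.prems raw_fn_subset_names[of P] by (auto intro: inj_on_subset)
    then show ?case using RServer.IH by (simp add: diff1)
  next
    case (RClient x y P)
    have "inj_on f (names P)" "inj_on f (insert y (raw_fn P))"
      using RClient.prems raw_fn_subset_names[of P] by (auto intro: inj_on_subset)
    then show ?case using RClient.IH by (simp add: diff1)
  next
    case (RDup x y1 y2 P)
    have "inj_on f (names P)" "inj_on f (insert y1 (insert y2 (raw_fn P)))"
      using RDup.prems raw_fn_subset_names[of P] by (auto intro: inj_on_subset)
    then show ?case using RDup.IH by (simp add: diff2)
  next
    case (RRes y1 y2 P)
    have "inj_on f (names P)" "inj_on f (insert y1 (insert y2 (raw_fn P)))"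
      using RRes.prems raw_fn_subset_names[of P] by (auto intro: inj_on_subset)
    then show ?case using RRes.IH by (simp add: diff2)
  next
    case (RCase x P Q)
    have "inj_on f (names P)" "inj_on f (names Q)"
      using RCase.prems by (auto intro: inj_on_subset)
    then show ?case using RCase.IH by (simp add: image_Un)
  next
    case (RPar P Q)
    have "inj_on f (names P)" "inj_on f (names Q)"
      using RPar.prems by (auto intro: inj_on_subset)
    then show ?case using RPar.IH by (simp add: image_Un)
  qed simp_all
qed

text \<open>Freshness of \<open>z\<close> makes the update injective on the names of
  \<open>P\<close>, so only \<open>y\<close> becomes \<open>z\<close>. Since both bodies in an alpha
  rule use the same \<open>z\<close>, their free names outside the binders agree.\<close>

lemma raw_fn_rename_fresh1:
  assumes "z \<notin> names P"
  shows "raw_fn (rename (id(y := z)) P) - {z} = raw_fn P - {y}"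
proof -
  have "inj_on (id(y := z)) (names P)"
    using assms by (auto simp: inj_on_def)
  then show ?thesis
    using assms raw_fn_subset_names[of P] by (auto simp: raw_fn_rename)
qed

lemma raw_fn_rename_fresh2:
  assumes "z1 \<noteq> z2" "z1 \<notin> names P" "z2 \<notin> names P"
  shows "raw_fn (rename (id(y1 := z1, y2 := z2)) P) - {z1, z2} = raw_fn P - {y1, y2}"
proof -
  have "inj_on (id(y1 := z1, y2 := z2)) (names P)"
    using assms by (auto simp: inj_on_def)
  then show ?thesis
    using assms raw_fn_subset_names[of P] by (auto simp: raw_fn_rename)
qed

lemma alpha_raw_fn: "alpha P Q \<Longrightarrow> raw_fn P = raw_fn Q"
proof (induction rule: alpha.induct)
  case (alpha_Out z P P' y y' x)
  then show ?case by simp (metis raw_fn_rename_fresh1)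
next
  case (alpha_Inp z P P' y y' x)
  then show ?case by simp (metis raw_fn_rename_fresh1)
next
  case (alpha_Server z P P' y y' x)
  then show ?case by simp (metis raw_fn_rename_fresh1)
next
  case (alpha_Client z P P' y y' x)
  then show ?case by simp (metis raw_fn_rename_fresh1)
next
  case (alpha_Dup z1 z2 P P' y1 y2 y1' y2' x)
  then show ?case by simp (metis raw_fn_rename_fresh2)
next
  case (alpha_Res z1 z2 P P' y1 y2 y1' y2')
  then show ?case by simp (metis raw_fn_rename_fresh2)
qed auto

lift_definition fn :: "process \<Rightarrow> name set" is raw_fn
  by (rule alpha_raw_fn)

lemma fn_simps [simp]:
  "fn (Out x y P) = insert x (fn P - {y})"
  "fn (Inp x y P) = insert x (fn P - {y})"
  "fn (Close x P) = insert x (fn P)"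
  "fn (Wait x P) = insert x (fn P)"
  "fn (SelL x P) = insert x (fn P)"
  "fn (SelR x P) = insert x (fn P)"
  "fn (Case x P Q) = insert x (fn P \<union> fn Q)"
  "fn (Server x y P) = insert x (fn P - {y})"
  "fn (Client x y P) = insert x (fn P - {y})"
  "fn (Dup x y1 y2 P) = insert x (fn P - {y1, y2})"
  "fn (Disp x P) = insert x (fn P)"
  "fn (Res y1 y2 P) = fn P - {y1, y2}"
  "fn (Par P Q) = fn P \<union> fn Q"
  "fn Nil0 = {}"
  "fn (Link x y) = {x, y}"
  by (transfer, simp)+

text \<open>Only injective renamings respect alpha-equivalence; for all others this is the identity.\<close>

lift_definition prename :: "(name \<Rightarrow> name) \<Rightarrow> process \<Rightarrow> process"
  is "\<lambda>f P. if inj f then rename f P else P"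
  by (auto intro: alpha_rename)

lemma prename_simps:
  assumes "inj f"
  shows
    "prename f (Out x y P) = Out (f x) (f y) (prename f P)"
    "prename f (Inp x y P) = Inp (f x) (f y) (prename f P)"
    "prename f (Close x P) = Close (f x) (prename f P)"
    "prename f (Wait x P) = Wait (f x) (prename f P)"
    "prename f (SelL x P) = SelL (f x) (prename f P)"
    "prename f (SelR x P) = SelR (f x) (prename f P)"
    "prename f (Case x P Q) = Case (f x) (prename f P) (prename f Q)"
    "prename f (Server x y P) = Server (f x) (f y) (prename f P)"
    "prename f (Client x y P) = Client (f x) (f y) (prename f P)"
    "prename f (Dup x y1 y2 P) = Dup (f x) (f y1) (f y2) (prename f P)"
    "prename f (Disp x P) = Disp (f x) (prename f P)"
    "prename f (Res y1 y2 P) = Res (f y1) (f y2) (prename f P)"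
    "prename f (Par P Q) = Par (prename f P) (prename f Q)"
    "prename f Nil0 = Nil0"
    "prename f (Link x y) = Link (f x) (f y)"
  using assms by (transfer, simp add: alpha_refl)+

section \<open>Telling constructors apart and inverting equations up to alpha\<close>

primrec raw_kind :: "name raw_process \<Rightarrow> nat" where
  "raw_kind (ROut x y P) = 0"
| "raw_kind (RInp x y P) = 1"
| "raw_kind (RClose x P) = 2"
| "raw_kind (RWait x P) = 3"
| "raw_kind (RSelL x P) = 4"
| "raw_kind (RSelR x P) = 5"
| "raw_kind (RCase x P Q) = 6"
| "raw_kind (RServer x y P) = 7"
| "raw_kind (RClient x y P) = 8"
| "raw_kind (RDup x y1 y2 P) = 9"
| "raw_kind (RDisp x P) = 10"
| "raw_kind (RRes y1 y2 P) = 11"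
| "raw_kind (RPar P Q) = 12"
| "raw_kind RNil = 13"
| "raw_kind (RLink x y) = 14"

text \<open>Tags the outermost constructor, so that distinctness of the lifted constructors needs no
  pairwise lemmas.\<close>

lift_definition kind :: "process \<Rightarrow> nat" is raw_kind
  by (erule alpha.cases) auto

lemma kind_simps [simp]:
  "kind (Out x y P) = 0"
  "kind (Inp x y P) = 1"
  "kind (Close x P) = 2"
  "kind (Wait x P) = 3"
  "kind (SelL x P) = 4"
  "kind (SelR x P) = 5"
  "kind (Case x P Q) = 6"
  "kind (Server x y P) = 7"
  "kind (Client x y P) = 8"
  "kind (Dup x y1 y2 P) = 9"
  "kind (Disp x P) = 10"
  "kind (Res y1 y2 P) = 11"
  "kind (Par P Q) = 12"
  "kind Nil0 = 13"
  "kind (Link x y) = 14"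
  by (transfer, simp)+

text \<open>The constructors of the quotient are not free, so rule inversion leaves equations
  between them; this discards those with different outermost constructors.\<close>

lemma process_neqE: "P = Q \<Longrightarrow> kind P \<noteq> kind Q \<Longrightarrow> R"
  by simp

lemma nonbinding_inject:
  "Close x P = Close x' P' \<longleftrightarrow> x = x' \<and> P = P'"
  "Wait x P = Wait x' P' \<longleftrightarrow> x = x' \<and> P = P'"
  "SelL x P = SelL x' P' \<longleftrightarrow> x = x' \<and> P = P'"
  "SelR x P = SelR x' P' \<longleftrightarrow> x = x' \<and> P = P'"
  "Disp x P = Disp x' P' \<longleftrightarrow> x = x' \<and> P = P'"
  "Par P Q = Par P' Q' \<longleftrightarrow> P = P' \<and> Q = Q'"
  by (transfer, auto elim!: alpha_elims(3-6,11,13) intro: alpha.intros(3-6,11,13))+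

text \<open>Passing through the common name \<open>z\<close> turns an alpha step under a binder into
  one injective renaming of the body. It fixes the free names outside the binder because
  alpha-equivalence preserves them.\<close>

lemma alpha_rebind1:
  assumes "alpha (rename (id(y := z)) P) (rename (id(y' := z)) P')"
    and "z \<notin> names P \<union> names P'"
  shows "\<exists>f. inj f \<and> alpha P (rename f P') \<and> f y' = y \<and> (\<forall>a \<in> raw_fn P' - {y'}. f a = a)"
proof (intro exI conjI ballI)
  \<comment> \<open>The right swap carries \<open>y'\<close> to \<open>z\<close>, the left one
    carries \<open>z\<close> to \<open>y\<close>; swaps are used in place of updates to have a map
    injective on all names.\<close>
  let ?f = "transpose y z \<circ> transpose y' z"
  show "inj ?f" by (simp add: inj_compose)
  show "?f y' = y" by simp
  \<comment> \<open>On a process without \<open>z\<close> the update acts as a swap, which is its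
    own inverse; applying the swap of \<open>y\<close> and \<open>z\<close> once more therefore
    restores \<open>P\<close>.\<close>
  have *: "rename (id(v := z)) R = rename (transpose v z) R" if "z \<notin> names R" for v R
    using that by (auto simp: transpose_def intro!: raw_process.map_cong0)
  have "alpha (rename (transpose y z) (rename (transpose y z) P))
      (rename (transpose y z) (rename (transpose y' z) P'))"
    using assms by (intro alpha_rename) (simp_all add: *)
  then show "alpha P (rename ?f P')"
    by (simp add: raw_process.map_comp raw_process.map_id0 flip: id_def)
  fix a assume a: "a \<in> raw_fn P' - {y'}"
  have "raw_fn P' - {y'} = raw_fn P - {y}"
    using raw_fn_rename_fresh1[of z P y] raw_fn_rename_fresh1[of z P' y'] alpha_raw_fn[OF assms(1)]
      assms(2) by auto
  with a have "a \<noteq> y" "a \<noteq> y'" "a \<noteq> z"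
    using assms(2) raw_fn_subset_names by blast+
  then show "?f a = a" by simp
qed

text \<open>Distinctness within each binder lets an injective \<open>f\<close> match the names
  position by position; with a repeated name the second position would shadow the first.\<close>

lemma alpha_rebind2:
  assumes "alpha (rename (id(y1 := z1, y2 := z2)) P) (rename (id(y1' := z1, y2' := z2)) P')"
    and "z1 \<noteq> z2" "z1 \<notin> names P \<union> names P'" "z2 \<notin> names P \<union> names P'"
    and "y1 \<noteq> y2" "y1' \<noteq> y2'"
  shows "\<exists>f. inj f \<and> alpha P (rename f P') \<and> f y1' = y1 \<and> f y2' = y2 \<and>
    (\<forall>a \<in> raw_fn P' - {y1', y2'}. f a = a)"
proof -
  let ?S = "names P \<union> names P' \<union> {z1, z2, y1, y2, y1', y2'}"
  \<comment> \<open>The given \<open>z1\<close> and \<open>z2\<close> may coincide with binders that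
    do not occur in the bodies, and then the swaps would interfere; \<open>w1\<close> and
    \<open>w2\<close> avoid the binders too.\<close>
  obtain w1 w2 where w: "w1 \<noteq> w2" "w1 \<notin> ?S" "w2 \<notin> ?S"
    by (rule obtain_fresh2[of ?S]) (auto simp: finite_names)
  have eq: "alpha (rename (id(y1 := w1, y2 := w2)) P) (rename (id(y1' := w1, y2' := w2)) P')"
    using alpha_fresh2[OF assms(1-4)] w by auto
  \<comment> \<open>\<open>?g\<close> performs the swaps for \<open>P\<close> in reverse order,
    hence inverts them, while \<open>?h\<close> performs those for \<open>P'\<close>.\<close>
  let ?g = "transpose y2 w2 \<circ> transpose y1 w1"
  let ?h = "transpose y1' w1 \<circ> transpose y2' w2"
  let ?f = "?g \<circ> ?h"
  have *: "rename (id(v1 := w1, v2 := w2)) R = rename (transpose v1 w1 \<circ> transpose v2 w2) R"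
    if "w1 \<notin> names R" "w2 \<notin> names R" "v1 \<noteq> v2" "{w1, w2} \<inter> {v1, v2} = {}" for v1 v2 R
    using that w(1) by (auto simp: transpose_def intro!: raw_process.map_cong0)
  have inj: "inj ?g" "inj ?f" by (simp_all add: inj_compose)
  have "alpha (rename ?g (rename (id(y1 := w1, y2 := w2)) P))
      (rename ?g (rename (id(y1' := w1, y2' := w2)) P'))"
    using eq inj(1) by (rule alpha_rename)
  moreover have "rename ?g (rename (id(y1 := w1, y2 := w2)) P) = P"
  proof -
    have "rename ?g (rename (id(y1 := w1, y2 := w2)) P)
        = rename (?g \<circ> (transpose y1 w1 \<circ> transpose y2 w2)) P"
      using w assms(5) by (subst *) (auto simp: raw_process.map_comp)
    also have "?g \<circ> (transpose y1 w1 \<circ> transpose y2 w2) = id"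
      by (auto simp: fun_eq_iff)
    finally show ?thesis by (simp only: raw_process.map_id)
  qed
  moreover have "rename ?g (rename (id(y1' := w1, y2' := w2)) P') = rename ?f P'"
    using w assms(6) by (subst *) (auto simp: raw_process.map_comp)
  ultimately have "alpha P (rename ?f P')" by simp
  moreover have "?f y1' = y1" "?f y2' = y2"
    using w assms(5,6) by (auto simp: transpose_def)
  moreover have "?f a = a" if a: "a \<in> raw_fn P' - {y1', y2'}" for a
  proof -
    have "raw_fn P' - {y1', y2'} = raw_fn P - {y1, y2}"
      using raw_fn_rename_fresh2[of w1 w2 P y1 y2] raw_fn_rename_fresh2[of w1 w2 P' y1' y2']
        alpha_raw_fn[OF eq] w by auto
    with a have "a \<notin> {y1, y2, y1', y2', w1, w2}"
      using w raw_fn_subset_names by blast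
    then show ?thesis by (simp add: transpose_def)
  qed
  ultimately show ?thesis using inj(2) by blast
qed

text \<open>\<open>Y\<close> stands for the names bound directly above \<open>P'\<close>. The
  relation records what equality of two binding processes says about their bodies.\<close>

definition rebinds :: "(name \<Rightarrow> name) \<Rightarrow> process \<Rightarrow> name set \<Rightarrow> process \<Rightarrow> bool" where
  "rebinds f P' Y P \<longleftrightarrow> inj f \<and> P = prename f P' \<and> (\<forall>a \<in> fn P' - Y. f a = a)"

lemma binding1_eqD:
  "Out x y P = Out x' y' P' \<Longrightarrow> x = x' \<and> (\<exists>f. rebinds f P' {y'} P \<and> f y' = y)"
  "Inp x y P = Inp x' y' P' \<Longrightarrow> x = x' \<and> (\<exists>f. rebinds f P' {y'} P \<and> f y' = y)"
  "Client x y P = Client x' y' P' \<Longrightarrow> x = x' \<and> (\<exists>f. rebinds f P' {y'} P \<and> f y' = y)"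
  unfolding rebinds_def
  \<comment> \<open>\<open>conj_cong\<close> makes \<open>inj f\<close> available to resolve the
    conditional in the definition of \<open>prename\<close>.\<close>
  by (transfer, erule alpha_elims, drule alpha_rebind1, simp, simp cong: conj_cong, blast)+

lemma binding2_eqD:
  "Dup x y1 y2 P = Dup x' y1' y2' P' \<Longrightarrow> y1 \<noteq> y2 \<Longrightarrow> y1' \<noteq> y2' \<Longrightarrow>
    x = x' \<and> (\<exists>f. rebinds f P' {y1', y2'} P \<and> f y1' = y1 \<and> f y2' = y2)"
  "Res y1 y2 P = Res y1' y2' P' \<Longrightarrow> y1 \<noteq> y2 \<Longrightarrow> y1' \<noteq> y2' \<Longrightarrow>
    \<exists>f. rebinds f P' {y1', y2'} P \<and> f y1' = y1 \<and> f y2' = y2"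
  unfolding rebinds_def
  by (transfer, erule alpha_elims, drule alpha_rebind2, simp, simp, simp, simp, simp,
      simp cong: conj_cong, blast)+

section \<open>Partition judgements\<close>

lemma Sum_image_image_mset:
  "\<Sum>\<^sub># (image_mset (image_mset f) N) = image_mset f (\<Sum>\<^sub># N)"
  by (induction N) auto

lemma distinct_names_image:
  assumes "inj f" "distinct_names N"
  shows "distinct_names (image_mset (image_mset f) N)"
proof -
  have "count (image_mset f M) x \<le> 1" if "\<forall>a. count M a \<le> 1" for M x
  proof (cases "x \<in> range f")
    case True
    then obtain a where a: "x = f a" by blast
    have "f -` {f a} = {a}" using assms(1) by (auto dest: injD)
    then have "count (image_mset f M) x \<le> count M a"
      by (cases "a \<in># M") (simp_all add: a count_image_mset)
    then show ?thesis using that le_trans by blast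
  next
    case False
    then have "count (image_mset f M) x = 0" by (auto simp: count_eq_zero_iff)
    then show ?thesis by simp
  qed
  then show ?thesis
    using assms(2) unfolding distinct_names_def Sum_image_image_mset by blast
qed

text \<open>Every rule is equivariant, binders being renamed along with all other names; the
  distinctness premises survive because an injective image does not raise multiplicities.\<close>

lemma partitioning_prename:
  assumes "P \<tturnstile> N" "inj f"
  shows "prename f P \<tturnstile> image_mset (image_mset f) N"
  using assms(1)
proof (induction rule: partitioning.induct)
  case (P_Ax x y)
  then show ?case using distinct_names_image[OF assms(2) P_Ax]
    by (simp add: prename_simps[OF assms(2)] partitioning.P_Ax)
next
  case (P_Cut P G \<Gamma> x \<Delta> y)
  then show ?case
    using partitioning.P_Cut[of "prename f P" "image_mset (image_mset f) G" "image_mset f \<Gamma>" "f x"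
        "image_mset f \<Delta>" "f y"]
    by (simp add: prename_simps[OF assms(2)])
next
  case (P_Mix P G Q H)
  then show ?case using distinct_names_image[OF assms(2) P_Mix.hyps(3)]
    by (simp add: prename_simps[OF assms(2)] partitioning.P_Mix)
next
  case P_Mix0
  show ?case by (simp add: prename_simps[OF assms(2)] partitioning.P_Mix0)
next
  case (P_Tensor P G \<Gamma> y \<Delta> x)
  then show ?case
    using partitioning.P_Tensor[of "prename f P" "image_mset (image_mset f) G" "image_mset f \<Gamma>" "f y"
        "image_mset f \<Delta>" "f x"]
    by (simp add: prename_simps[OF assms(2)])
next
  case (P_One P G x)
  then show ?case
    using partitioning.P_One[of "prename f P" "image_mset (image_mset f) G" "f x"]
      distinct_names_image[OF assms(2) P_One.hyps(2)]
    by (simp add: prename_simps[OF assms(2)])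
next
  case (P_Parr P G \<Gamma> y x)
  then show ?case
    using partitioning.P_Parr[of "prename f P" "image_mset (image_mset f) G" "image_mset f \<Gamma>" "f y" "f x"]
    by (simp add: prename_simps[OF assms(2)])
next
  case (P_Bot P G \<Gamma> x)
  then show ?case
    using partitioning.P_Bot[of "prename f P" "image_mset (image_mset f) G" "image_mset f \<Gamma>" "f x"]
      distinct_names_image[OF assms(2) P_Bot.hyps(2)]
    by (simp add: prename_simps[OF assms(2)])
next
  case (P_Plus1 P G \<Gamma> x)
  then show ?case
    using partitioning.P_Plus1[of "prename f P" "image_mset (image_mset f) G" "image_mset f \<Gamma>" "f x"]
    by (simp add: prename_simps[OF assms(2)])
next
  case (P_Plus2 P G \<Gamma> x)
  then show ?case
    using partitioning.P_Plus2[of "prename f P" "image_mset (image_mset f) G" "image_mset f \<Gamma>" "f x"]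
    by (simp add: prename_simps[OF assms(2)])
next
  case (P_With P \<Gamma> x Q)
  then show ?case
    using partitioning.P_With[of "prename f P" "image_mset f \<Gamma>" "f x"]
    by (simp add: prename_simps[OF assms(2)])
next
  case (P_OfCourse P \<Gamma> y x)
  then show ?case
    using partitioning.P_OfCourse[of "prename f P" "image_mset f \<Gamma>" "f y" "f x"]
      distinct_names_image[OF assms(2) P_OfCourse.hyps(2)]
    by (simp add: prename_simps[OF assms(2)])
next
  case (P_WhyNot P G \<Gamma> y x)
  then show ?case
    using partitioning.P_WhyNot[of "prename f P" "image_mset (image_mset f) G" "image_mset f \<Gamma>" "f y" "f x"]
      distinct_names_image[OF assms(2) P_WhyNot.hyps(2)]
    by (simp add: prename_simps[OF assms(2)])
next
  case (P_Weaken P G \<Gamma> x)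
  then show ?case
    using partitioning.P_Weaken[of "prename f P" "image_mset (image_mset f) G" "image_mset f \<Gamma>" "f x"]
      distinct_names_image[OF assms(2) P_Weaken.hyps(2)]
    by (simp add: prename_simps[OF assms(2)])
next
  case (P_Contract P G \<Gamma> x1 x2 x)
  then show ?case
    using partitioning.P_Contract[of "prename f P" "image_mset (image_mset f) G" "image_mset f \<Gamma>"
        "f x1" "f x2" "f x"] distinct_names_image[OF assms(2) P_Contract.hyps(2)]
    by (simp add: prename_simps[OF assms(2)])
qed

section \<open>Distinctness of names and the free names of a partition\<close>

lemma distinct_names_add_mset:
  "distinct_names (add_mset (add_mset x \<Gamma>) G) \<longleftrightarrow>
    x \<notin># \<Gamma> \<and> x \<notin># \<Sum>\<^sub># G \<and> distinct_names (add_mset \<Gamma> G)"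
proof -
  have "(\<forall>y. count (add_mset x M) y \<le> 1) \<longleftrightarrow> x \<notin># M \<and> (\<forall>y. count M y \<le> 1)" for M :: "name multiset"
  proof
    assume *: "\<forall>y. count (add_mset x M) y \<le> 1"
    have "count M y \<le> 1" for y using *[rule_format, of y] by (auto split: if_splits)
    moreover have "x \<notin># M" using *[rule_format, of x] by (simp add: count_eq_zero_iff)
    ultimately show "x \<notin># M \<and> (\<forall>y. count M y \<le> 1)" by blast
  qed (auto simp: not_in_iff)
  from this[of "\<Gamma> + \<Sum>\<^sub># G"] show ?thesis
    by (simp add: distinct_names_def)
qed

text \<open>Reaches a name in the second environment of a premise, as in the cut and tensor rules.
  Together with \<open>distinct_names_add_mset\<close> it lets simplification extract all freshness
  facts.\<close>

lemma distinct_names_add_mset2: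
  "distinct_names (add_mset \<Delta> (add_mset (add_mset x \<Gamma>) G)) \<longleftrightarrow>
    x \<notin># \<Delta> \<and> x \<notin># \<Gamma> \<and> x \<notin># \<Sum>\<^sub># G \<and> distinct_names (add_mset \<Delta> (add_mset \<Gamma> G))"
  using distinct_names_add_mset[of x \<Gamma> "add_mset \<Delta> G"]
  by (auto simp: add_mset_commute[of \<Delta>])

text \<open>A name leaves the partition only by being bound, and distinctness in the premise
  excludes further occurrences of it. So the set of names depends on the process alone.\<close>

lemma partitioning_fn: "P \<tturnstile> N \<Longrightarrow> set_mset (\<Sum>\<^sub># N) = fn P"
proof (induction rule: partitioning.induct)
  case (P_Cut P G \<Gamma> x \<Delta> y)
  show ?case
    using partitioning_distinct_names[OF P_Cut.hyps] P_Cut.IH[symmetric]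
    by (auto simp: distinct_names_add_mset distinct_names_add_mset2)
next
  case (P_Tensor P G \<Gamma> y \<Delta> x)
  show ?case
    using partitioning_distinct_names[OF P_Tensor.hyps] P_Tensor.IH[symmetric]
    by (auto simp: distinct_names_add_mset distinct_names_add_mset2)
next
  case (P_Parr P G \<Gamma> y x)
  show ?case
    using partitioning_distinct_names[OF P_Parr.hyps] P_Parr.IH[symmetric]
    by (auto simp: distinct_names_add_mset distinct_names_add_mset2)
next
  case (P_OfCourse P \<Gamma> y x)
  show ?case
    using partitioning_distinct_names[OF P_OfCourse.hyps(1)] P_OfCourse.IH[symmetric]
    by (auto simp: distinct_names_add_mset distinct_names_add_mset2)
next
  case (P_WhyNot P G \<Gamma> y x)
  show ?case
    using partitioning_distinct_names[OF P_WhyNot.hyps(1)] P_WhyNot.IH[symmetric]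
    by (auto simp: distinct_names_add_mset distinct_names_add_mset2)
next
  case (P_Contract P G \<Gamma> x1 x2 x)
  show ?case
    using partitioning_distinct_names[OF P_Contract.hyps(1)] P_Contract.IH[symmetric]
    by (auto simp: distinct_names_add_mset distinct_names_add_mset2)
qed (simp_all, blast+)

section \<open>Inverting partition judgements at prescribed bound names\<close>

lemma image_mset_fixed: "(\<And>x. x \<in># M \<Longrightarrow> f x = x) \<Longrightarrow> image_mset f M = M"
  using image_mset_cong[of M f id] by simp

text \<open>Names of the passive part \<open>G\<close> are free in \<open>P'\<close> and not in
  \<open>Y\<close>, so \<open>f\<close> fixes them; only the environments in \<open>H\<close>, on
  which the rule acts, can change.\<close>

lemma rebinds_partitioning:
  assumes "rebinds f P' Y P" "P' \<tturnstile> G + H" "Y \<inter> set_mset (\<Sum>\<^sub># G) = {}"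
  shows "P \<tturnstile> G + image_mset (image_mset f) H"
proof -
  have "set_mset (\<Sum>\<^sub># G) \<subseteq> fn P'"
    using partitioning_fn[OF assms(2)] by auto
  then have "\<Gamma> \<in># G \<Longrightarrow> a \<in># \<Gamma> \<Longrightarrow> f a = a" for \<Gamma> a
    using assms(1,3) by (auto simp: rebinds_def)
  then have "image_mset (image_mset f) G = G"
    by (intro image_mset_fixed) auto
  then show ?thesis
    using partitioning_prename[OF assms(2), of f] assms(1) by (auto simp: rebinds_def)
qed

text \<open>Handles what remains of the active environments once the bound names are set aside:
  these names are free in \<open>P'\<close> and outside \<open>Y\<close>.\<close>

lemma rebinds_env:
  assumes "rebinds f P' Y P" "P' \<tturnstile> N" "\<Gamma> \<subseteq># \<Sum>\<^sub># N" "Y \<inter> set_mset \<Gamma> = {}"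
  shows "image_mset f \<Gamma> = \<Gamma>"
proof (rule image_mset_fixed)
  fix a assume a: "a \<in># \<Gamma>"
  then have "a \<in># \<Sum>\<^sub># N" using assms(3) by (rule mset_subset_eqD[rotated])
  then have "a \<in> fn P'" using partitioning_fn[OF assms(2)] by blast
  with a show "f a = a" using assms(1,4) by (auto simp: rebinds_def)
qed

text \<open>The derivation may have chosen other bound names \<open>x'\<close> and
  \<open>y'\<close>. The renaming obtained from alpha-equality carries its premise over to
  \<open>x\<close> and \<open>y\<close> and leaves everything else in place.\<close>

lemma partitioning_ResE:
  assumes "Res x y P \<tturnstile> N" "x \<noteq> y"
  obtains G \<Gamma> \<Delta> where "N = G + {#\<Gamma> + \<Delta>#}" "P \<tturnstile> G + {#\<Gamma> + {#x#}, \<Delta> + {#y#}#}"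
  using assms(1)
proof (cases rule: partitioning.cases)
  case (P_Cut P' G \<Gamma> x' \<Delta> y')
  have d: "x' \<noteq> y'" "{x', y'} \<inter> set_mset (\<Sum>\<^sub># G) = {}" "{x', y'} \<inter> set_mset \<Gamma> = {}"
    "{x', y'} \<inter> set_mset \<Delta> = {}"
    using partitioning_distinct_names[OF P_Cut(3)]
    by (auto simp: distinct_names_add_mset distinct_names_add_mset2)
  obtain f where f: "rebinds f P' {x', y'} P" "f x' = x" "f y' = y"
    using binding2_eqD(2)[OF P_Cut(1) assms(2) d(1)] by blast
  have "image_mset f \<Gamma> = \<Gamma>" "image_mset f \<Delta> = \<Delta>"
    using d by (auto intro!: rebinds_env[OF f(1) P_Cut(3)] simp: subseteq_mset_def)
  then show thesis
    using that[OF P_Cut(2)] rebinds_partitioning[OF f(1) P_Cut(3) d(2)] f(2,3) by simp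
qed (erule process_neqE, simp (no_asm))+

lemma partitioning_OutE:
  assumes "Out x y P \<tturnstile> N"
  obtains G \<Gamma> \<Delta> where "N = G + {#\<Gamma> + \<Delta> + {#x#}#}" "P \<tturnstile> G + {#\<Gamma> + {#y#}, \<Delta> + {#x#}#}"
  using assms(1)
proof (cases rule: partitioning.cases)
  case (P_Tensor P' G \<Gamma> y' \<Delta> x')
  have d: "{y'} \<inter> set_mset (\<Sum>\<^sub># G) = {}" "{y'} \<inter> set_mset \<Gamma> = {}"
    "{y'} \<inter> set_mset (\<Delta> + {#x'#}) = {}"
    using partitioning_distinct_names[OF P_Tensor(3)]
    by (auto simp: distinct_names_add_mset distinct_names_add_mset2)
  obtain f where f: "x = x'" "rebinds f P' {y'} P" "f y' = y"
    using binding1_eqD(1)[OF P_Tensor(1)] by blast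
  \<comment> \<open>The subject \<open>x'\<close> is free in the body and differs from
    \<open>y'\<close>, so \<open>f\<close> fixes it along with \<open>\<Delta>\<close>.\<close>
  have "image_mset f \<Gamma> = \<Gamma>" "image_mset f (\<Delta> + {#x'#}) = \<Delta> + {#x'#}"
    by (rule rebinds_env[OF f(2) P_Tensor(3) _ d(2)], simp add: subseteq_mset_def,
        rule rebinds_env[OF f(2) P_Tensor(3) _ d(3)], simp add: subseteq_mset_def)
  then show thesis
    using that[of G \<Gamma> \<Delta>] P_Tensor(2) rebinds_partitioning[OF f(2) P_Tensor(3) d(1)] f(1,3) by simp
qed (erule process_neqE, simp (no_asm))+

lemma partitioning_InpE:
  assumes "Inp x y P \<tturnstile> N"
  obtains G \<Gamma> where "N = G + {#\<Gamma> + {#x#}#}" "P \<tturnstile> G + {#\<Gamma> + {#y, x#}#}"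
  using assms(1)
proof (cases rule: partitioning.cases)
  case (P_Parr P' G \<Gamma> y' x')
  have d: "{y'} \<inter> set_mset (\<Sum>\<^sub># G) = {}" "{y'} \<inter> set_mset (\<Gamma> + {#x'#}) = {}"
    using partitioning_distinct_names[OF P_Parr(3)]
    by (auto simp: distinct_names_add_mset distinct_names_add_mset2)
  obtain f where f: "x = x'" "rebinds f P' {y'} P" "f y' = y"
    using binding1_eqD(2)[OF P_Parr(1)] by blast
  have "image_mset f (\<Gamma> + {#x'#}) = \<Gamma> + {#x'#}"
    by (rule rebinds_env[OF f(2) P_Parr(3) _ d(2)]) (simp add: subseteq_mset_def)
  then show thesis
    using that[of G \<Gamma>] P_Parr(2) rebinds_partitioning[OF f(2) P_Parr(3) d(1)] f(1,3) by simp
qed (erule process_neqE, simp (no_asm))+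

lemma partitioning_ClientE:
  assumes "Client x y P \<tturnstile> N"
  obtains G \<Gamma> where "N = G + {#\<Gamma> + {#x#}#}" "P \<tturnstile> G + {#\<Gamma> + {#y#}#}"
  using assms(1)
proof (cases rule: partitioning.cases)
  case (P_WhyNot P' G \<Gamma> y' x')
  have d: "{y'} \<inter> set_mset (\<Sum>\<^sub># G) = {}" "{y'} \<inter> set_mset \<Gamma> = {}"
    using partitioning_distinct_names[OF P_WhyNot(3)]
    by (auto simp: distinct_names_add_mset distinct_names_add_mset2)
  obtain f where f: "x = x'" "rebinds f P' {y'} P" "f y' = y"
    using binding1_eqD(3)[OF P_WhyNot(1)] by blast
  have "image_mset f \<Gamma> = \<Gamma>"
    by (rule rebinds_env[OF f(2) P_WhyNot(3) _ d(2)]) (simp add: subseteq_mset_def)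
  then show thesis
    using that[of G \<Gamma>] P_WhyNot(2) rebinds_partitioning[OF f(2) P_WhyNot(3) d(1)] f(1,3) by simp
qed (erule process_neqE, simp (no_asm))+

lemma partitioning_DupE:
  assumes "Dup x x1 x2 P \<tturnstile> N" "x1 \<noteq> x2"
  obtains G \<Gamma> where "N = G + {#\<Gamma> + {#x#}#}" "P \<tturnstile> G + {#\<Gamma> + {#x1, x2#}#}"
  using assms(1)
proof (cases rule: partitioning.cases)
  case (P_Contract P' G \<Gamma> x1' x2' x')
  have d: "x1' \<noteq> x2'" "{x1', x2'} \<inter> set_mset (\<Sum>\<^sub># G) = {}" "{x1', x2'} \<inter> set_mset \<Gamma> = {}"
    using partitioning_distinct_names[OF P_Contract(3)]
    by (auto simp: distinct_names_add_mset distinct_names_add_mset2)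
  obtain f where f: "x = x'" "rebinds f P' {x1', x2'} P" "f x1' = x1" "f x2' = x2"
    using binding2_eqD(1)[OF P_Contract(1) assms(2) d(1)] by blast
  have "image_mset f \<Gamma> = \<Gamma>"
    by (rule rebinds_env[OF f(2) P_Contract(3) _ d(3)]) (simp add: subseteq_mset_def)
  then show thesis
    using that[of G \<Gamma>] P_Contract(2) rebinds_partitioning[OF f(2) P_Contract(3) d(2)] f(1,3,4) by simp
qed (erule process_neqE, simp (no_asm))+

lemma partitioning_ParE:
  assumes "Par P Q \<tturnstile> N"
  obtains G H where "N = G + H" "P \<tturnstile> G" "Q \<tturnstile> H"
  using assms
proof (cases rule: partitioning.cases)
  case (P_Mix P' G Q' H)
  then show thesis using that[of G H] by (simp add: nonbinding_inject)
qed (erule process_neqE, simp (no_asm))+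

lemma partitioning_CloseE:
  assumes "Close x P \<tturnstile> N"
  obtains G where "N = G + {#{#x#}#}" "P \<tturnstile> G"
  using assms
proof (cases rule: partitioning.cases)
  case (P_One P' G x')
  then show thesis using that[of G] by (simp add: nonbinding_inject)
qed (erule process_neqE, simp (no_asm))+

lemma partitioning_WaitE:
  assumes "Wait x P \<tturnstile> N"
  obtains G \<Gamma> where "N = G + {#\<Gamma> + {#x#}#}" "P \<tturnstile> G + {#\<Gamma>#}"
  using assms
proof (cases rule: partitioning.cases)
  case (P_Bot P' G \<Gamma> x')
  then show thesis using that[of G \<Gamma>] by (simp add: nonbinding_inject)
qed (erule process_neqE, simp (no_asm))+

lemma partitioning_DispE:
  assumes "Disp x P \<tturnstile> N"
  obtains G \<Gamma> where "N = G + {#\<Gamma> + {#x#}#}" "P \<tturnstile> G + {#\<Gamma>#}"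
  using assms
proof (cases rule: partitioning.cases)
  case (P_Weaken P' G \<Gamma> x')
  then show thesis using that[of G \<Gamma>] by (simp add: nonbinding_inject)
qed (erule process_neqE, simp (no_asm))+

lemma partitioning_SelLE:
  assumes "SelL x P \<tturnstile> N"
  obtains G \<Gamma> where "N = G + {#\<Gamma> + {#x#}#}" "P \<tturnstile> G + {#\<Gamma> + {#x#}#}"
  using assms
proof (cases rule: partitioning.cases)
  case (P_Plus1 P' G \<Gamma> x')
  then show thesis using that[of G \<Gamma>] by (simp add: nonbinding_inject)
qed (erule process_neqE, simp (no_asm))+

lemma partitioning_SelRE:
  assumes "SelR x P \<tturnstile> N"
  obtains G \<Gamma> where "N = G + {#\<Gamma> + {#x#}#}" "P \<tturnstile> G + {#\<Gamma> + {#x#}#}"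
  using assms
proof (cases rule: partitioning.cases)
  case (P_Plus2 P' G \<Gamma> x')
  then show thesis using that[of G \<Gamma>] by (simp add: nonbinding_inject)
qed (erule process_neqE, simp (no_asm))+

text \<open>For these constructors the number of environments suffices: a single environment is
  determined by its typed names, so the premises need not be inverted.\<close>

lemma partitioning_singleton:
  "Link x y \<tturnstile> N \<Longrightarrow> \<exists>\<Gamma>. N = {#\<Gamma>#}"
  "Case x P Q \<tturnstile> N \<Longrightarrow> \<exists>\<Gamma>. N = {#\<Gamma>#}"
  "Server x y P \<tturnstile> N \<Longrightarrow> \<exists>\<Gamma>. N = {#\<Gamma>#}"
  by (erule partitioning.cases; (erule process_neqE, simp (no_asm); fail | blast))+

lemma partitioning_Nil0: "Nil0 \<tturnstile> N \<Longrightarrow> N = {#}"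
  by (erule partitioning.cases; (erule process_neqE, simp (no_asm); fail | blast))

section \<open>Retyping along a partition\<close>

lemma strip_simps [simp]:
  "strip {#} = {#}"
  "strip (G + H) = strip G + strip H"
  "strip (add_mset \<Gamma> G) = add_mset (image_mset fst \<Gamma>) (strip G)"
  by (simp_all add: strip_def)

lemma Sum_strip: "\<Sum>\<^sub># (strip G) = image_mset fst (\<Sum>\<^sub># G)"
  by (simp add: strip_def Sum_image_image_mset)

lemma partitioning_hyperenv: "P \<tturnstile> strip G \<Longrightarrow> hyperenv G"
  by (simp add: hyperenv_def partitioning_distinct_names)

lemma partitioning_strip_fn: "P \<tturnstile> strip G \<Longrightarrow> fst ` set_mset (\<Sum>\<^sub># G) = fn P"
  by (metis partitioning_fn Sum_strip set_image_mset)

text \<open>Each typing rule erases to its partition counterpart. This gives access to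
  \<open>partitioning_fn\<close> for the components of a typed parallel composition.\<close>

lemma typing_partitioning: "\<turnstile> P \<Colon> G \<Longrightarrow> P \<tturnstile> strip G"
proof (induction rule: typing.induct)
  case (T_Ax x A y)
  then show ?case using P_Ax[of x y] by (simp add: hyperenv_def)
next
  case (T_Cut P \<G> \<Gamma> x A \<Delta> y)
  then show ?case using P_Cut[of P "strip \<G>" "image_mset fst \<Gamma>" x "image_mset fst \<Delta>" y] by simp
next
  case (T_Mix P \<G> Q \<H>)
  then show ?case using P_Mix[of P "strip \<G>" Q "strip \<H>"] by (simp add: hyperenv_def)
next
  case T_Mix0
  show ?case by (simp add: P_Mix0)
next
  case (T_Tensor P \<G> \<Gamma> y A \<Delta> x B)
  then show ?case using P_Tensor[of P "strip \<G>" "image_mset fst \<Gamma>" y "image_mset fst \<Delta>" x] by simp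
next
  case (T_One P \<G> x)
  then show ?case using P_One[of P "strip \<G>" x] by (simp add: hyperenv_def)
next
  case (T_Parr P \<G> \<Gamma> y A x B)
  then show ?case using P_Parr[of P "strip \<G>" "image_mset fst \<Gamma>" y x] by simp
next
  case (T_Bot P \<G> \<Gamma> x)
  then show ?case using P_Bot[of P "strip \<G>" "image_mset fst \<Gamma>" x] by (simp add: hyperenv_def)
next
  case (T_Plus1 P \<G> \<Gamma> x A B)
  then show ?case using P_Plus1[of P "strip \<G>" "image_mset fst \<Gamma>" x] by simp
next
  case (T_Plus2 P \<G> \<Gamma> x B A)
  then show ?case using P_Plus2[of P "strip \<G>" "image_mset fst \<Gamma>" x] by simp
next
  case (T_With P \<Gamma> x A Q B)
  then show ?case using P_With[of P "image_mset fst \<Gamma>" x Q] by simp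
next
  case (T_OfCourse P \<Gamma> y A x)
  then show ?case using P_OfCourse[of P "image_mset fst \<Gamma>" y x] by (simp add: hyperenv_def)
next
  case (T_WhyNot P \<G> \<Gamma> y A x)
  then show ?case using P_WhyNot[of P "strip \<G>" "image_mset fst \<Gamma>" y x] by (simp add: hyperenv_def)
next
  case (T_Weaken P \<G> \<Gamma> x A)
  then show ?case using P_Weaken[of P "strip \<G>" "image_mset fst \<Gamma>" x] by (simp add: hyperenv_def)
next
  case (T_Contract P \<G> \<Gamma> x1 A x2 x)
  then show ?case using P_Contract[of P "strip \<G>" "image_mset fst \<Gamma>" x1 x2 x] by (simp add: hyperenv_def)
qed

text \<open>Erasure acts on each environment separately, so a split prescribed by a partition lifts
  to the typed hyperenvironment.\<close>

lemma strip_eq_plusE: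
  assumes "strip G = M + N"
  obtains G1 G2 where "G = G1 + G2" "strip G1 = M" "strip G2 = N"
  using image_mset_eq_plusD[OF assms[unfolded strip_def]] by (auto simp: strip_def)

lemma strip_eq_singletonE:
  assumes "strip G = {#N#}"
  obtains \<Gamma> where "G = {#\<Gamma>#}" "image_mset fst \<Gamma> = N"
  using msed_map_invR[OF assms[unfolded strip_def]] by auto

text \<open>\<open>T\<close> is whatever type \<open>x\<close> happens to carry in \<open>G\<close>;
  it is identified only later, through \<open>name_unique\<close>.\<close>

lemma strip_eq_add_nameE:
  assumes "strip G = M + {#N + {#x#}#}"
  obtains G1 \<Gamma> T where "G = G1 + {#\<Gamma> + {#(x, T)#}#}" "strip G1 = M" "image_mset fst \<Gamma> = N"
proof -
  obtain G1 \<Gamma> where G: "G = G1 + {#\<Gamma>#}" "strip G1 = M" "image_mset fst \<Gamma> = N + {#x#}"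
    using assms by (metis strip_eq_plusE strip_eq_singletonE)
  from G(3) obtain \<Gamma>1 p where "\<Gamma> = add_mset p \<Gamma>1" "fst p = x" "image_mset fst \<Gamma>1 = N"
    using msed_map_invR[of fst \<Gamma> x N] by auto
  then show thesis using that[of G1 \<Gamma>1 "snd p"] G by (cases p) auto
qed

text \<open>Erasure keeps multiplicities of names, so \<open>x\<close> occurs once in the flattened
  hyperenvironment; a second type would be a second occurrence.\<close>

lemma name_unique:
  assumes "hyperenv G" "\<Sum>\<^sub># G = add_mset (x, A) M" "\<Sum>\<^sub># G = add_mset (x, B) N"
  shows "A = B" "M = N"
proof -
  have "count (image_mset fst (\<Sum>\<^sub># G)) x \<le> 1"
    using assms(1) by (simp only: hyperenv_def distinct_names_def Sum_strip)
  then have "x \<notin># image_mset fst M"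
    by (simp only: assms(2)) (simp add: count_eq_zero_iff)
  then have "(x, B) \<notin># M" by force
  then show "A = B" using assms(2,3) by (metis insert_noteq_member prod.inject)
  then show "M = N" using assms(2,3) by simp
qed

text \<open>Uniqueness of names forces the type of the principal name to agree in both hyperenvironments.\<close>

lemma strip_principalE:
  assumes "hyperenv G'" "strip G' = M + {#N + {#x#}#}"
    and "\<Sum>\<^sub># (G + {#\<Gamma> + {#(x, T)#}#}) = \<Sum>\<^sub># G'"
  obtains G1 \<Gamma>1 where "G' = G1 + {#\<Gamma>1 + {#(x, T)#}#}" "strip G1 = M" "image_mset fst \<Gamma>1 = N"
    "\<Sum>\<^sub># G + \<Gamma> = \<Sum>\<^sub># G1 + \<Gamma>1"
proof -
  obtain G1 \<Gamma>1 T' where G': "G' = G1 + {#\<Gamma>1 + {#(x, T')#}#}" "strip G1 = M" "image_mset fst \<Gamma>1 = N"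
    using assms(2) by (rule strip_eq_add_nameE)
  have "\<Sum>\<^sub># G' = add_mset (x, T) (\<Sum>\<^sub># G + \<Gamma>)" "\<Sum>\<^sub># G' = add_mset (x, T') (\<Sum>\<^sub># G1 + \<Gamma>1)"
    using assms(3) G'(1) by (simp_all add: ac_simps)
  from name_unique[OF assms(1) this] show thesis using that G' by blast
qed

lemma Sum_eq_singleton_eq:
  assumes "\<Sum>\<^sub># {#\<Gamma>#} = \<Sum>\<^sub># G'" "\<exists>N. strip G' = {#N#}"
  shows "G' = {#\<Gamma>#}"
  using assms by (auto elim: strip_eq_singletonE)

text \<open>Equality of the flattened multisets serves as the induction invariant: it ignores
  grouping, and it passes to premises by cancelling the principal name and adding the same typed
  bound names on both sides.\<close>

lemma typing_retype:
  assumes "\<turnstile> P \<Colon> G" "P \<tturnstile> strip G'" "\<Sum>\<^sub># G = \<Sum>\<^sub># G'"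
  shows "\<turnstile> P \<Colon> G'"
  using assms
proof (induction arbitrary: G' rule: typing.induct)
  case (T_Ax x A y)
  then show ?case
    \<comment> \<open>\<open>G'\<close> is forced to be the hyperenvironment of the derivation
      itself, so the rule is reapplied to its original premises. The cases \<open>T_With\<close> and
      \<open>T_OfCourse\<close> go the same way.\<close>
    using Sum_eq_singleton_eq partitioning_singleton(1) typing.T_Ax by metis
next
  case (T_With P \<Gamma> x A Q B)
  then show ?case
    using Sum_eq_singleton_eq partitioning_singleton(2) typing.T_With by metis
next
  case (T_OfCourse P \<Gamma> y A x)
  then show ?case
    using Sum_eq_singleton_eq partitioning_singleton(3) typing.T_OfCourse by metis
next
  case T_Mix0
  then have "G' = {#}" by (auto dest: partitioning_Nil0 simp: strip_def)
  then show ?case by (simp add: typing.T_Mix0)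
next
  case (T_Cut P \<G> \<Gamma> x A \<Delta> y)
  have "x \<noteq> y"
    using typing_hyperenv[OF T_Cut.hyps]
    by (auto simp: hyperenv_def distinct_names_add_mset distinct_names_add_mset2)
  with T_Cut.prems(1) obtain M N1 N2 where
    N: "strip G' = M + {#N1 + N2#}" "P \<tturnstile> M + {#N1 + {#x#}, N2 + {#y#}#}"
    by (rule partitioning_ResE)
  obtain G1 \<Gamma>' where G': "G' = G1 + {#\<Gamma>'#}" "strip G1 = M" "image_mset fst \<Gamma>' = N1 + N2"
    using N(1) by (metis strip_eq_plusE strip_eq_singletonE)
  \<comment> \<open>The division of the merged environment follows the partition and may differ from
    that into \<open>\<Gamma>\<close> and \<open>\<Delta>\<close>.\<close>
  obtain \<Gamma>1 \<Delta>1 where \<Gamma>': "\<Gamma>' = \<Gamma>1 + \<Delta>1" "image_mset fst \<Gamma>1 = N1" "image_mset fst \<Delta>1 = N2"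
    using image_mset_eq_plusD[OF G'(3)] by blast
  \<comment> \<open>The cut type \<open>A\<close> is taken from the typing derivation, since the
    partition carries no types.\<close>
  have "\<turnstile> P \<Colon> G1 + {#\<Gamma>1 + {#(x, A)#}, \<Delta>1 + {#(y, dual A)#}#}"
    using T_Cut.prems(2) N(2) G' \<Gamma>' by (intro T_Cut.IH) (auto simp: ac_simps)
  then show ?case unfolding G'(1) \<Gamma>'(1) by (rule typing.T_Cut)
next
  case (T_Mix P \<G> Q \<H>)
  obtain M N where N: "strip G' = M + N" "P \<tturnstile> M" "Q \<tturnstile> N"
    using T_Mix.prems(1) by (rule partitioning_ParE)
  obtain G1 H1 where G': "G' = G1 + H1" "strip G1 = M" "strip H1 = N"
    using N(1) by (rule strip_eq_plusE)
  have hyp: "hyperenv G'" using T_Mix.prems(1) by (rule partitioning_hyperenv)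
  \<comment> \<open>In both splits the two halves carry exactly the free names of \<open>P\<close>
    and of \<open>Q\<close>.\<close>
  have fns: "fst ` set_mset (\<Sum>\<^sub># \<G>) = fn P" "fst ` set_mset (\<Sum>\<^sub># \<H>) = fn Q"
    "fst ` set_mset (\<Sum>\<^sub># G1) = fn P" "fst ` set_mset (\<Sum>\<^sub># H1) = fn Q"
    using T_Mix.hyps(1,2)[THEN typing_partitioning] N(2,3) G'(2,3)
    by (simp_all only: partitioning_strip_fn)
  have disj: "fn P \<inter> fn Q = {}"
  proof -
    have "count (\<Sum>\<^sub># M) a + count (\<Sum>\<^sub># N) a \<le> 1" for a
      using hyp unfolding hyperenv_def N(1) distinct_names_def by simp
    then have "a \<in># \<Sum>\<^sub># M \<Longrightarrow> a \<notin># \<Sum>\<^sub># N" for a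
      by (metis One_nat_def add_is_1 count_eq_zero_iff le_Suc_eq le_zero_eq add_is_0)
    then show ?thesis
      unfolding N(2,3)[THEN partitioning_fn, symmetric] by blast
  qed
  \<comment> \<open>As \<open>P\<close> and \<open>Q\<close> share no free name, selecting the names
    of \<open>P\<close> recovers the left summand; equal sums thus have equal summands.\<close>
  have filt: "filter_mset (\<lambda>p. fst p \<in> fn P) (X + Y) = X"
    if "fst ` set_mset X = fn P" "fst ` set_mset Y = fn Q" for X Y :: "(name \<times> ty) multiset"
  proof -
    have "filter_mset (\<lambda>p. fst p \<in> fn P) X = X"
      using that by (auto simp: filter_mset_eq_conv)
    moreover have "filter_mset (\<lambda>p. fst p \<in> fn P) Y = {#}"
      using that disj by (auto simp: filter_mset_eq_conv)
    ultimately show ?thesis by simp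
  qed
  have sum: "\<Sum>\<^sub># \<G> + \<Sum>\<^sub># \<H> = \<Sum>\<^sub># G1 + \<Sum>\<^sub># H1"
    using T_Mix.prems(2) G'(1) by simp
  then have "\<Sum>\<^sub># \<G> = \<Sum>\<^sub># G1"
    using filt[OF fns(1,2)] filt[OF fns(3,4)] by simp
  moreover from this sum have "\<Sum>\<^sub># \<H> = \<Sum>\<^sub># H1" by simp
  ultimately show ?case
    using T_Mix.IH[of G1] T_Mix.IH(2)[of H1] N G' hyp by (auto intro: typing.T_Mix)
next
  case (T_Tensor P \<G> \<Gamma> y A \<Delta> x B)
  obtain M N1 N2 where
    N: "strip G' = M + {#(N1 + N2) + {#x#}#}" "P \<tturnstile> M + {#N1 + {#y#}, N2 + {#x#}#}"
    using T_Tensor.prems(1) by (rule partitioning_OutE)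
  obtain G1 \<Gamma>' where G': "G' = G1 + {#\<Gamma>' + {#(x, Tensor A B)#}#}" "strip G1 = M"
    "image_mset fst \<Gamma>' = N1 + N2" "\<Sum>\<^sub># \<G> + (\<Gamma> + \<Delta>) = \<Sum>\<^sub># G1 + \<Gamma>'"
    using partitioning_hyperenv[OF T_Tensor.prems(1)] N(1) T_Tensor.prems(2) by (rule strip_principalE)
  obtain \<Gamma>1 \<Delta>1 where \<Gamma>': "\<Gamma>' = \<Gamma>1 + \<Delta>1" "image_mset fst \<Gamma>1 = N1" "image_mset fst \<Delta>1 = N2"
    using image_mset_eq_plusD[OF G'(3)] by blast
  have "\<turnstile> P \<Colon> G1 + {#\<Gamma>1 + {#(y, A)#}, \<Delta>1 + {#(x, B)#}#}"
    using N(2) G' \<Gamma>' by (intro T_Tensor.IH) (auto simp: ac_simps)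
  then show ?case unfolding G'(1) \<Gamma>'(1) by (rule typing.T_Tensor)
next
  case (T_One P \<G> x)
  \<comment> \<open>The empty multiset is written out to match the shape \<open>N + {#x#}\<close>
    expected by \<open>strip_principalE\<close>.\<close>
  obtain M where N: "strip G' = M + {#{#} + {#x#}#}" "P \<tturnstile> M"
    using T_One.prems(1) by (auto elim: partitioning_CloseE)
  have hyp: "hyperenv G'" using T_One.prems(1) by (rule partitioning_hyperenv)
  obtain G1 \<Gamma>' where G': "G' = G1 + {#\<Gamma>' + {#(x, One)#}#}" "strip G1 = M"
    "image_mset fst \<Gamma>' = {#}" "\<Sum>\<^sub># \<G> + {#} = \<Sum>\<^sub># G1 + \<Gamma>'"
    by (rule strip_principalE[OF hyp N(1), of \<G> "{#}" One]) (use T_One.prems(2) in auto)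
  then have "\<turnstile> P \<Colon> G1"
    using N(2) by (intro T_One.IH) auto
  then show ?case using G' hyp typing.T_One[of P G1 x] by simp
next
  case (T_Parr P \<G> \<Gamma> y A x B)
  obtain M N1 where N: "strip G' = M + {#N1 + {#x#}#}" "P \<tturnstile> M + {#N1 + {#y, x#}#}"
    using T_Parr.prems(1) by (rule partitioning_InpE)
  obtain G1 \<Gamma>1 where G': "G' = G1 + {#\<Gamma>1 + {#(x, Parr A B)#}#}" "strip G1 = M"
    "image_mset fst \<Gamma>1 = N1" "\<Sum>\<^sub># \<G> + \<Gamma> = \<Sum>\<^sub># G1 + \<Gamma>1"
    using partitioning_hyperenv[OF T_Parr.prems(1)] N(1) T_Parr.prems(2) by (rule strip_principalE)
  have "\<turnstile> P \<Colon> G1 + {#\<Gamma>1 + {#(y, A), (x, B)#}#}"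
    using N(2) G' by (intro T_Parr.IH) (auto simp: ac_simps)
  then show ?case unfolding G'(1) by (rule typing.T_Parr)
next
  case (T_Bot P \<G> \<Gamma> x)
  obtain M N1 where N: "strip G' = M + {#N1 + {#x#}#}" "P \<tturnstile> M + {#N1#}"
    using T_Bot.prems(1) by (rule partitioning_WaitE)
  \<comment> \<open>The distinctness premise of the typing rule comes from the partition judgement,
    erasure preserving names.\<close>
  have hyp: "hyperenv G'" using T_Bot.prems(1) by (rule partitioning_hyperenv)
  obtain G1 \<Gamma>1 where G': "G' = G1 + {#\<Gamma>1 + {#(x, Bot)#}#}" "strip G1 = M"
    "image_mset fst \<Gamma>1 = N1" "\<Sum>\<^sub># \<G> + \<Gamma> = \<Sum>\<^sub># G1 + \<Gamma>1"
    using hyp N(1) T_Bot.prems(2) by (rule strip_principalE)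
  have "\<turnstile> P \<Colon> G1 + {#\<Gamma>1#}"
    using N(2) G' by (intro T_Bot.IH) (auto simp: ac_simps)
  then show ?case using hyp unfolding G'(1) by (rule typing.T_Bot)
next
  case (T_Plus1 P \<G> \<Gamma> x A B)
  obtain M N1 where N: "strip G' = M + {#N1 + {#x#}#}" "P \<tturnstile> M + {#N1 + {#x#}#}"
    using T_Plus1.prems(1) by (rule partitioning_SelLE)
  obtain G1 \<Gamma>1 where G': "G' = G1 + {#\<Gamma>1 + {#(x, Plus A B)#}#}" "strip G1 = M"
    "image_mset fst \<Gamma>1 = N1" "\<Sum>\<^sub># \<G> + \<Gamma> = \<Sum>\<^sub># G1 + \<Gamma>1"
    using partitioning_hyperenv[OF T_Plus1.prems(1)] N(1) T_Plus1.prems(2) by (rule strip_principalE)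
  have "\<turnstile> P \<Colon> G1 + {#\<Gamma>1 + {#(x, A)#}#}"
    using N(2) G' by (intro T_Plus1.IH) (auto simp: ac_simps)
  then show ?case unfolding G'(1) by (rule typing.T_Plus1)
next
  case (T_Plus2 P \<G> \<Gamma> x B A)
  obtain M N1 where N: "strip G' = M + {#N1 + {#x#}#}" "P \<tturnstile> M + {#N1 + {#x#}#}"
    using T_Plus2.prems(1) by (rule partitioning_SelRE)
  obtain G1 \<Gamma>1 where G': "G' = G1 + {#\<Gamma>1 + {#(x, Plus A B)#}#}" "strip G1 = M"
    "image_mset fst \<Gamma>1 = N1" "\<Sum>\<^sub># \<G> + \<Gamma> = \<Sum>\<^sub># G1 + \<Gamma>1"
    using partitioning_hyperenv[OF T_Plus2.prems(1)] N(1) T_Plus2.prems(2) by (rule strip_principalE)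
  have "\<turnstile> P \<Colon> G1 + {#\<Gamma>1 + {#(x, B)#}#}"
    using N(2) G' by (intro T_Plus2.IH) (auto simp: ac_simps)
  then show ?case unfolding G'(1) by (rule typing.T_Plus2)
next
  case (T_WhyNot P \<G> \<Gamma> y A x)
  obtain M N1 where N: "strip G' = M + {#N1 + {#x#}#}" "P \<tturnstile> M + {#N1 + {#y#}#}"
    using T_WhyNot.prems(1) by (rule partitioning_ClientE)
  have hyp: "hyperenv G'" using T_WhyNot.prems(1) by (rule partitioning_hyperenv)
  obtain G1 \<Gamma>1 where G': "G' = G1 + {#\<Gamma>1 + {#(x, WhyNot A)#}#}" "strip G1 = M"
    "image_mset fst \<Gamma>1 = N1" "\<Sum>\<^sub># \<G> + \<Gamma> = \<Sum>\<^sub># G1 + \<Gamma>1"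
    using hyp N(1) T_WhyNot.prems(2) by (rule strip_principalE)
  have "\<turnstile> P \<Colon> G1 + {#\<Gamma>1 + {#(y, A)#}#}"
    using N(2) G' by (intro T_WhyNot.IH) (auto simp: ac_simps)
  then show ?case using hyp unfolding G'(1) by (rule typing.T_WhyNot)
next
  case (T_Weaken P \<G> \<Gamma> x A)
  obtain M N1 where N: "strip G' = M + {#N1 + {#x#}#}" "P \<tturnstile> M + {#N1#}"
    using T_Weaken.prems(1) by (rule partitioning_DispE)
  have hyp: "hyperenv G'" using T_Weaken.prems(1) by (rule partitioning_hyperenv)
  obtain G1 \<Gamma>1 where G': "G' = G1 + {#\<Gamma>1 + {#(x, WhyNot A)#}#}" "strip G1 = M"
    "image_mset fst \<Gamma>1 = N1" "\<Sum>\<^sub># \<G> + \<Gamma> = \<Sum>\<^sub># G1 + \<Gamma>1"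
    using hyp N(1) T_Weaken.prems(2) by (rule strip_principalE)
  have "\<turnstile> P \<Colon> G1 + {#\<Gamma>1#}"
    using N(2) G' by (intro T_Weaken.IH) (auto simp: ac_simps)
  then show ?case using hyp unfolding G'(1) by (rule typing.T_Weaken)
next
  case (T_Contract P \<G> \<Gamma> x1 A x2 x)
  \<comment> \<open>Inverting the partition needs distinct bound names; the typing premise
    guarantees this.\<close>
  have "x1 \<noteq> x2"
    using typing_hyperenv[OF T_Contract.hyps(1)]
    by (auto simp: hyperenv_def distinct_names_add_mset distinct_names_add_mset2)
  with T_Contract.prems(1) obtain M N1 where
    N: "strip G' = M + {#N1 + {#x#}#}" "P \<tturnstile> M + {#N1 + {#x1, x2#}#}"
    by (rule partitioning_DupE)
  have hyp: "hyperenv G'" using T_Contract.prems(1) by (rule partitioning_hyperenv)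
  obtain G1 \<Gamma>1 where G': "G' = G1 + {#\<Gamma>1 + {#(x, WhyNot A)#}#}" "strip G1 = M"
    "image_mset fst \<Gamma>1 = N1" "\<Sum>\<^sub># \<G> + \<Gamma> = \<Sum>\<^sub># G1 + \<Gamma>1"
    using hyp N(1) T_Contract.prems(2) by (rule strip_principalE)
  have "\<turnstile> P \<Colon> G1 + {#\<Gamma>1 + {#(x1, WhyNot A), (x2, WhyNot A)#}#}"
    using N(2) G' by (intro T_Contract.IH) (auto simp: ac_simps)
  then show ?case using hyp unfolding G'(1) by (rule typing.T_Contract)
qed

section \<open>From shufflings to equal multisets of typed names\<close>

lemma count_le_count_image_mset: "count M a \<le> count (image_mset f M) (f a)"
  by (induction M) auto

text \<open>A typed name occurs at most as often as its bare name, hence at most once, so the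
  multisets are determined by their sets of elements.\<close>

lemma hyperenv_Sum_eqI:
  assumes "hyperenv G" "hyperenv G'" "set_mset (\<Sum>\<^sub># G) = set_mset (\<Sum>\<^sub># G')"
  shows "\<Sum>\<^sub># G = \<Sum>\<^sub># G'"
proof (rule multiset_eqI)
  fix p :: "name \<times> ty"
  have le: "count (\<Sum>\<^sub># H) p \<le> 1" if "hyperenv H" for H
  proof -
    have "count (\<Sum>\<^sub># H) p \<le> count (image_mset fst (\<Sum>\<^sub># H)) (fst p)"
      by (rule count_le_count_image_mset)
    also have "\<dots> \<le> 1"
      using that by (simp only: hyperenv_def distinct_names_def Sum_strip)
    finally show ?thesis .
  qed
  have "count (\<Sum>\<^sub># G) p > 0 \<longleftrightarrow> count (\<Sum>\<^sub># G') p > 0"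
    using assms(3) by (simp only: count_greater_zero_iff)
  then show "count (\<Sum>\<^sub># G) p = count (\<Sum>\<^sub># G') p"
    using le[OF assms(1)] le[OF assms(2)] by linarith
qed

theorem theorem2p4:
  fixes P :: process and \<G> \<G>' :: henv
  assumes "hyperenv \<G>" and "hyperenv \<G>'"
    and "\<turnstile> P \<Colon> \<G>"
    and "P \<tturnstile> strip \<G>'"
    and "shuffling \<G> \<G>'"
  shows "\<turnstile> P \<Colon> \<G>'"
proof -
  \<comment> \<open>Membership in the flattened multiset is exactly occurrence in some environment,
    which is how \<open>shuffling\<close> compares typed names.\<close>
  have "set_mset (\<Sum>\<^sub># \<G>) = set_mset (\<Sum>\<^sub># \<G>')"
    using assms(5) by (auto simp: shuffling_def)
  with assms(1,2) have "\<Sum>\<^sub># \<G> = \<Sum>\<^sub># \<G>'"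
    by (rule hyperenv_Sum_eqI)
  with assms(3,4) show ?thesis by (rule typing_retype)
qed

end
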